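(* Let the Finsler space $(M,F)$, $\dim M=N\ge3$, be conformally automorphic to the Riemannian space $(M,S)$ with constant degree $H$ through the transformation $t=t(x,y)$, and let $$N^k{}_m=-y^k_i\left(\frac{\partial t^i}{\partial x^m}+a^i{}_{hm}t^h\right)$$ (so that $\frac{\partial F}{\partial x^m}+N^k{}_m\frac{\partial F}{\partial y^k}=0$). Then, with $N^k{}_{mnj}=\dfrac{\partial^2N^k{}_m}{\partial y^n\,\partial y^j}$ and $y_k=\frac12\,\partial F^2/\partial y^k$, $$y_kN^k{}_{mnj}=0$$ identically.
   Context: $M$ is a $C^\infty$ manifold with local coordinates $x^i$; $y^i$ are the induced coordinates of tangent vectors $y\in T_xM\setminus0$; repeated indices are summed over $1,\dots,N$; considerations are local. The Finsler metric function $F(x,y)$ is smooth, positive, positively homogeneous of degree 1 in $y$, with positive-definite $g_{ij}=\frac12\,\partial^2F^2/\partial y^i\partial y^j$. $S(x,y)=\sqrt{a_{ij}(x)y^iy^j}$ is a Riemannian metric function and $a^i{}_{kn}(x)$ are the Christoffel symbols of $a_{ij}$. Definition. $(M,F)$ is conformally automorphic to $(M,S)$, of degree $H>0$, if there is a smooth family of invertible smooth transformations $y\mapsto t=t(x,y)$ of nonzero tangent vectors at $x$ into nonzero tangent vectors at the same $x$ such that: (i) $t^m(x,ky)=k^{H}t^m(x,y)$ for all $k>0$; (ii) $F(x,y)=1\iff S(x,t(x,y))=1$; (iii) $g_{mn}(x,y)=p^2\,a_{ij}(x)\,t^i_m t^j_n$, where $t^i_m=\partial t^i/\partial y^m$ and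 $p=p(x,y)>0$. Notation: $y=y(x,t)$ is the inverse transformation and $y^k_i=\partial y^k/\partial t^i$, evaluated at $t=t(x,y)$. *)

theory Defs
  imports "HOL-Analysis.Analysis"
begin

text \<open>
  Everything is written in a coordinate chart: a point is \<open>x \<in> U\<close> with \<open>U\<close> open in
  \<open>\<real>\<^sup>N\<close>, where \<open>N = CARD('n)\<close>, and a tangent vector at \<open>x\<close> is given by its
  components in \<open>real^'n\<close>.
\<close>

abbreviation slit :: "(real^'n) set" where
  "slit \<equiv> - {0}"

text \<open>Class \<open>C\<^sup>k\<close> and smoothness; meant for open sets.\<close>

fun Ck_on :: "nat \<Rightarrow> 'a::euclidean_space set \<Rightarrow> ('a \<Rightarrow> 'b::real_normed_vector) \<Rightarrow> bool" where
  "Ck_on 0 S f \<longleftrightarrow> continuous_on S f"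
| "Ck_on (Suc k) S f \<longleftrightarrow>
     (\<forall>x\<in>S. f differentiable (at x)) \<and>
     (\<forall>v. Ck_on k S (\<lambda>x. frechet_derivative f (at x) v))"

definition smooth_on :: "'a::euclidean_space set \<Rightarrow> ('a \<Rightarrow> 'b::real_normed_vector) \<Rightarrow> bool" where
  "smooth_on S f \<longleftrightarrow> (\<forall>k. Ck_on k S f)"

definition partial_deriv :: "'n \<Rightarrow> (real^'n \<Rightarrow> real) \<Rightarrow> real^'n \<Rightarrow> real" where
  "partial_deriv k f v = deriv (\<lambda>s. f (v + s *\<^sub>R axis k 1)) 0"

definition pos_def_matrix :: "real^'n^'n \<Rightarrow> bool" where
  "pos_def_matrix A \<longleftrightarrow> (\<forall>v. v \<noteq> 0 \<longrightarrow> 0 < v \<bullet> (A *v v))"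

definition finsler_tensor ::
    "(real^'n \<Rightarrow> real^'n \<Rightarrow> real) \<Rightarrow> real^'n \<Rightarrow> real^'n \<Rightarrow> real^'n^'n" where
  "finsler_tensor F x y =
     (\<chi> i j. (1/2) * partial_deriv i (partial_deriv j (\<lambda>v. (F x v)\<^sup>2)) y)"

definition finsler_metric_on ::
    "(real^'n) set \<Rightarrow> (real^'n \<Rightarrow> real^'n \<Rightarrow> real) \<Rightarrow> bool" where
  "finsler_metric_on U F \<longleftrightarrow>
     smooth_on (U \<times> slit) (\<lambda>(x, y). F x y) \<and>
     (\<forall>x\<in>U. \<forall>y\<in>slit.
        0 < F x y \<and>
        (\<forall>k>0. F x (k *\<^sub>R y) = k * F x y) \<and>
        pos_def_matrix (finsler_tensor F x y))"

definition riemannian_metric_on ::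
    "(real^'n) set \<Rightarrow> (real^'n \<Rightarrow> real^'n^'n) \<Rightarrow> bool" where
  "riemannian_metric_on U a \<longleftrightarrow>
     smooth_on U a \<and>
     (\<forall>x\<in>U. transpose (a x) = a x \<and> pos_def_matrix (a x))"

definition riemannian_fun ::
    "(real^'n \<Rightarrow> real^'n^'n) \<Rightarrow> real^'n \<Rightarrow> real^'n \<Rightarrow> real" where
  "riemannian_fun a x y = sqrt (\<Sum>i\<in>UNIV. \<Sum>j\<in>UNIV. a x $ i $ j * y $ i * y $ j)"

text \<open>The symbol with upper index \<open>i\<close> and lower indices \<open>k\<close>, \<open>n\<close>.\<close>

definition christoffel ::
    "(real^'n \<Rightarrow> real^'n^'n) \<Rightarrow> real^'n \<Rightarrow> 'n \<Rightarrow> 'n \<Rightarrow> 'n \<Rightarrow> real" where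
  "christoffel a x i k n =
     (1/2) * (\<Sum>j\<in>UNIV. matrix_inv (a x) $ i $ j *
       (partial_deriv k (\<lambda>z. a z $ j $ n) x
        + partial_deriv n (\<lambda>z. a z $ j $ k) x
        - partial_deriv j (\<lambda>z. a z $ k $ n) x))"

text \<open>
  The transformation \<open>y \<mapsto> t x y\<close> exhibits \<open>F\<close> as conformally automorphic, of degree \<open>H\<close>,
  to the Riemannian metric \<open>a\<close>.  No regularity of the factor \<open>p\<close> is demanded.
\<close>

definition conformally_automorphic_via ::
    "(real^'n) set \<Rightarrow> (real^'n \<Rightarrow> real^'n \<Rightarrow> real) \<Rightarrow> (real^'n \<Rightarrow> real^'n^'n) \<Rightarrow> real
     \<Rightarrow> (real^'n \<Rightarrow> real^'n \<Rightarrow> real^'n) \<Rightarrow> bool" where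
  "conformally_automorphic_via U F a H t \<longleftrightarrow>
     0 < H \<and>
     smooth_on (U \<times> slit) (\<lambda>(x, y). t x y) \<and>
     (\<forall>x\<in>U. bij_betw (t x) slit slit) \<and>
     (\<forall>x\<in>U. \<forall>y\<in>slit. \<forall>k>0. t x (k *\<^sub>R y) = (k powr H) *\<^sub>R t x y) \<and>
     (\<forall>x\<in>U. \<forall>y\<in>slit. F x y = 1 \<longleftrightarrow> riemannian_fun a x (t x y) = 1) \<and>
     (\<exists>p. \<forall>x\<in>U. \<forall>y\<in>slit. 0 < p x y \<and>
        (\<forall>m n. finsler_tensor F x y $ m $ n =
           (p x y)\<^sup>2 * (\<Sum>i\<in>UNIV. \<Sum>j\<in>UNIV. a x $ i $ j
              * partial_deriv m (\<lambda>v. t x v $ i) y * partial_deriv n (\<lambda>v. t x v $ j) y)))"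

definition inverse_transf ::
    "(real^'n \<Rightarrow> real^'n \<Rightarrow> real^'n) \<Rightarrow> real^'n \<Rightarrow> real^'n \<Rightarrow> real^'n" where
  "inverse_transf t x = inv_into slit (t x)"

text \<open>The coefficient with upper index \<open>k\<close> and lower index \<open>m\<close>.\<close>

definition nonlinear_conn ::
    "(real^'n \<Rightarrow> real^'n^'n) \<Rightarrow> (real^'n \<Rightarrow> real^'n \<Rightarrow> real^'n)
     \<Rightarrow> 'n \<Rightarrow> 'n \<Rightarrow> real^'n \<Rightarrow> real^'n \<Rightarrow> real" where
  "nonlinear_conn a t k m x y =
     - (\<Sum>i\<in>UNIV. partial_deriv i (\<lambda>u. inverse_transf t x u $ k) (t x y) *
          (partial_deriv m (\<lambda>z. t z y $ i) x
           + (\<Sum>h\<in>UNIV. christoffel a x i h m * t x y $ h)))"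

definition covector :: "(real^'n \<Rightarrow> real^'n \<Rightarrow> real) \<Rightarrow> 'n \<Rightarrow> real^'n \<Rightarrow> real^'n \<Rightarrow> real" where
  "covector F k x y = (1/2) * partial_deriv k (\<lambda>v. (F x v)\<^sup>2) y"

end

theory Submission
  imports Defs
begin

text \<open>
  Since \<open>t\<close> is homogeneous of degree \<open>H\<close>, \<open>F\<^sup>2\<^sup>H = a(t,t)\<close>. The coefficients \<open>N\<close> are chosen
  so that \<open>d\<^sub>m = \<partial>/\<partial>x\<^sup>m + N\<^sup>k\<^sub>m \<partial>/\<partial>y\<^sup>k\<close> transports \<open>t\<close> parallelly for the Levi-Civita connection of
  \<open>a\<close>; hence \<open>d\<^sub>m F = 0\<close>, and differentiating the transport equation in \<open>y\<close> gives
  \<open>d\<^sub>m h\<^sub>n\<^sub>j + N\<^sup>k\<^sub>m\<^sub>n h\<^sub>k\<^sub>j + N\<^sup>k\<^sub>m\<^sub>j h\<^sub>n\<^sub>k = 0\<close> for the pulled-back tensor \<open>h\<^sub>n\<^sub>j = a(t\<^sub>n, t\<^sub>j)\<close>. Euler's theorem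
  applied to \<open>g = p\<^sup>2 h\<close> identifies \<open>p\<^sup>2\<close> as \<open>F\<^sup>2 / (H\<^sup>2 a(t,t))\<close>, which \<open>d\<^sub>m\<close> annihilates, so the same
  identity holds for \<open>g\<close>. Differentiating \<open>d\<^sub>m F\<^sup>2 = 0\<close> twice in \<open>y\<close> gives that identity with the
  extra term \<open>y\<^sub>k N\<^sup>k\<^sub>m\<^sub>n\<^sub>j\<close>, which therefore vanishes.
\<close>

subsection \<open>Calculus of smooth functions\<close>

lemma frechet_eqI: "(f has_derivative f') (at x) \<Longrightarrow> frechet_derivative f (at x) v = f' v"
  using frechet_derivative_at by metis

lemma Ck_on_differentiable: "Ck_on (Suc k) S f \<Longrightarrow> x \<in> S \<Longrightarrow> f differentiable (at x)"
  by simp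

text \<open>The derivative of a product or of a reciprocal still contains undifferentiated factors,
  so the inductions for those operations have to lower the class of a factor by one.\<close>

lemma Ck_on_Suc_imp: "Ck_on (Suc k) S f \<Longrightarrow> Ck_on k S f"
proof (induction k arbitrary: f)
  case 0
  then show ?case
    by (auto intro!: continuous_at_imp_continuous_on differentiable_imp_continuous_within)
next
  case (Suc k)
  have "Ck_on k S (\<lambda>x. frechet_derivative f (at x) v)" for v
    using Suc.IH Suc.prems by (metis Ck_on.simps(2))
  moreover have "\<forall>x\<in>S. f differentiable (at x)"
    using Suc.prems by (metis Ck_on.simps(2))
  ultimately show ?case by simp
qed

text \<open>On an open set, agreement of two functions passes to their derivatives at each point, so
  it survives every level of the recursion.\<close>

lemma Ck_on_cong:
  assumes "open S" "\<And>x. x \<in> S \<Longrightarrow> f x = g x" "Ck_on k S f"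
  shows "Ck_on k S g"
  using assms(2,3)
proof (induction k arbitrary: f g)
  case 0
  then show ?case by (simp cong: continuous_on_cong)
next
  case (Suc k)
  have der: "(g has_derivative frechet_derivative f (at x)) (at x)" if "x \<in> S" for x
    using Suc.prems that assms(1)
    by (meson Ck_on.simps(2) frechet_derivative_works has_derivative_transform_within_open)
  have "Ck_on k S (\<lambda>x. frechet_derivative g (at x) v)" for v
  proof (rule Suc.IH)
    show "Ck_on k S (\<lambda>x. frechet_derivative f (at x) v)" using Suc.prems by simp
  qed (metis der frechet_eqI)
  then show ?case using der by (auto simp: differentiable_def)
qed

text \<open>Lets each closure proof below name its derivative by the usual differentiation rule;
  congruence then trades the named derivative for \<open>frechet_derivative\<close>.\<close>

lemma Ck_on_SucI:
  assumes "open S" "\<And>x. x \<in> S \<Longrightarrow> (f has_derivative f' x) (at x)"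
    and "\<And>v. Ck_on k S (\<lambda>x. f' x v)"
  shows "Ck_on (Suc k) S f"
proof -
  have "Ck_on k S (\<lambda>x. frechet_derivative f (at x) v)" for v
    by (rule Ck_on_cong[OF assms(1) _ assms(3)]) (simp add: frechet_eqI[OF assms(2)])
  then show ?thesis using assms(2) by (auto simp: differentiable_def)
qed

lemma Ck_on_SucD:
  assumes "Ck_on (Suc k) S f"
  shows "x \<in> S \<Longrightarrow> (f has_derivative frechet_derivative f (at x)) (at x)"
    and "Ck_on k S (\<lambda>x. frechet_derivative f (at x) v)"
  using assms by (auto simp: frechet_derivative_works[symmetric])

section \<open>Closure of the classes \<open>Ck_on\<close> under algebraic operations and
  substitution\<close>

lemma Ck_on_const: "Ck_on k S (\<lambda>x. c)"
  by (induction k arbitrary: c) auto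

lemma Ck_on_add:
  assumes "open S" "Ck_on k S f" "Ck_on k S g"
  shows "Ck_on k S (\<lambda>x. f x + g x)"
  using assms(2,3)
proof (induction k arbitrary: f g)
  case 0
  then show ?case by (simp add: continuous_on_add)
next
  case (Suc k)
  show ?case
  proof (rule Ck_on_SucI[OF assms(1)])
    show "((\<lambda>x. f x + g x) has_derivative
        (\<lambda>v. frechet_derivative f (at x) v + frechet_derivative g (at x) v)) (at x)"
      if "x \<in> S" for x
      using Suc.prems that by (intro has_derivative_add Ck_on_SucD(1))
    show "Ck_on k S (\<lambda>x. frechet_derivative f (at x) v + frechet_derivative g (at x) v)" for v
      using Suc.prems by (intro Suc.IH Ck_on_SucD(2))
  qed
qed

lemma Ck_on_mult:
  fixes f g :: "'a::euclidean_space \<Rightarrow> real"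
  assumes "open S" "Ck_on k S f" "Ck_on k S g"
  shows "Ck_on k S (\<lambda>x. f x * g x)"
  using assms(2,3)
proof (induction k arbitrary: f g)
  case 0
  then show ?case by (simp add: continuous_on_mult)
next
  case (Suc k)
  show ?case
  proof (rule Ck_on_SucI[OF assms(1)])
    show "((\<lambda>x. f x * g x) has_derivative
        (\<lambda>v. f x * frechet_derivative g (at x) v + frechet_derivative f (at x) v * g x)) (at x)"
      if "x \<in> S" for x
      using Suc.prems that by (intro has_derivative_mult Ck_on_SucD(1))
    show "Ck_on k S (\<lambda>x. f x * frechet_derivative g (at x) v + frechet_derivative f (at x) v * g x)"
      for v
      using Suc.prems by (intro Ck_on_add assms(1) Suc.IH Ck_on_SucD(2) Ck_on_Suc_imp[of k S f]
          Ck_on_Suc_imp[of k S g])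
  qed
qed

lemma Ck_on_inverse:
  fixes f :: "'a::euclidean_space \<Rightarrow> real"
  assumes "open S" "\<And>x. x \<in> S \<Longrightarrow> f x \<noteq> 0" "Ck_on k S f"
  shows "Ck_on k S (\<lambda>x. inverse (f x))"
  using assms(2,3)
proof (induction k arbitrary: f)
  case 0
  then show ?case by (auto intro!: continuous_on_inverse)
next
  case (Suc k)
  have inv: "Ck_on k S (\<lambda>x. inverse (f x))"
    using Suc Ck_on_Suc_imp by blast
  show ?case
  proof (rule Ck_on_SucI[OF assms(1)])
    \<comment> \<open>The sign is written as a factor \<open>-1\<close>, so that constants and
      products cover the whole expression. The reciprocal reappears in its own derivative, one class
      lower, where the induction hypothesis applies.\<close>
    show "((\<lambda>x. inverse (f x)) has_derivative
        (\<lambda>v. -1 * (inverse (f x) * frechet_derivative f (at x) v * inverse (f x)))) (at x)"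
      if "x \<in> S" for x
      using Suc.prems(1)[OF that] Ck_on_SucD(1)[OF Suc.prems(2) that]
      by (auto intro!: derivative_eq_intros)
    show "Ck_on k S (\<lambda>x. -1 * (inverse (f x) * frechet_derivative f (at x) v * inverse (f x)))"
      for v
      using inv Ck_on_SucD(2)[OF Suc.prems(2)] by (intro Ck_on_mult Ck_on_const assms(1))
  qed
qed

text \<open>The inner map has the constant derivative \<open>L\<close>, so differentiating
  reproduces the same kind of composite with a directional derivative of \<open>f\<close> in place
  of \<open>f\<close>. The uses are restriction to a fibre and composition with a
  projection.\<close>

lemma Ck_on_affine_compose:
  assumes "open T" "bounded_linear L" "\<And>x. x \<in> T \<Longrightarrow> c + L x \<in> S" "Ck_on k S f"
  shows "Ck_on k T (\<lambda>x. f (c + L x))"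
  using assms(4)
proof (induction k arbitrary: f)
  case 0
  have "continuous_on T (\<lambda>x. c + L x)"
    by (intro continuous_intros linear_continuous_on assms(2))
  with 0 assms(3) show ?case
    by (auto intro: continuous_on_compose2)
next
  case (Suc k)
  show ?case
  proof (rule Ck_on_SucI[OF assms(1)])
    show "((\<lambda>x. f (c + L x)) has_derivative (\<lambda>v. frechet_derivative f (at (c + L x)) (L v))) (at x)"
      if "x \<in> T" for x
    proof (rule has_derivative_compose[where g=f])
      show "((\<lambda>x. c + L x) has_derivative L) (at x)"
        using bounded_linear_imp_has_derivative[OF assms(2)] by (auto intro!: derivative_eq_intros)
    qed (use Ck_on_SucD(1)[OF Suc.prems] assms(3) that in auto)
    show "Ck_on k T (\<lambda>x. frechet_derivative f (at (c + L x)) (L v))" for v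
      using Suc.IH Ck_on_SucD(2)[OF Suc.prems] by blast
  qed
qed

lemma Ck_on_linear_image:
  assumes "open S" "bounded_linear L" "Ck_on k S f"
  shows "Ck_on k S (\<lambda>x. L (f x))"
  using assms(3)
proof (induction k arbitrary: f)
  case 0
  then show ?case
    using assms(2) by (simp add: bounded_linear.continuous_on)
next
  case (Suc k)
  show ?case
  proof (rule Ck_on_SucI[OF assms(1)])
    show "((\<lambda>x. L (f x)) has_derivative (\<lambda>v. L (frechet_derivative f (at x) v))) (at x)"
      if "x \<in> S" for x
      using Suc.prems that by (intro bounded_linear.has_derivative[OF assms(2)] Ck_on_SucD(1))
    show "Ck_on k S (\<lambda>x. L (frechet_derivative f (at x) v))" for v
      using Suc.prems by (intro Suc.IH Ck_on_SucD(2))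
  qed
qed

section \<open>The corresponding rules for smooth functions\<close>

lemma smooth_on_differentiable: "smooth_on S f \<Longrightarrow> x \<in> S \<Longrightarrow> f differentiable (at x)"
  unfolding smooth_on_def by (metis Ck_on_differentiable)

lemma smooth_on_frechet: "smooth_on S f \<Longrightarrow> smooth_on S (\<lambda>x. frechet_derivative f (at x) v)"
  unfolding smooth_on_def by (metis Ck_on_SucD(2))

lemma smooth_on_continuous: "smooth_on S f \<Longrightarrow> continuous_on S f"
  unfolding smooth_on_def by (metis Ck_on.simps(1))

lemma smooth_on_cong:
  "smooth_on S f \<Longrightarrow> open S \<Longrightarrow> (\<And>x. x \<in> S \<Longrightarrow> f x = g x) \<Longrightarrow> smooth_on S g"
  by (simp add: smooth_on_def Ck_on_cong[where f=f])

lemma smooth_on_const: "smooth_on S (\<lambda>x. c)"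
  by (simp add: smooth_on_def Ck_on_const)

lemma smooth_on_add:
  "open S \<Longrightarrow> smooth_on S f \<Longrightarrow> smooth_on S g \<Longrightarrow> smooth_on S (\<lambda>x. f x + g x)"
  by (simp add: smooth_on_def Ck_on_add)

lemma smooth_on_sum:
  "open S \<Longrightarrow> (\<And>i. i \<in> I \<Longrightarrow> smooth_on S (f i)) \<Longrightarrow> smooth_on S (\<lambda>x. \<Sum>i\<in>I. f i x)"
  by (induction I rule: infinite_finite_induct) (auto intro: smooth_on_const smooth_on_add)

lemma smooth_on_mult:
  fixes f g :: "'a::euclidean_space \<Rightarrow> real"
  shows "open S \<Longrightarrow> smooth_on S f \<Longrightarrow> smooth_on S g \<Longrightarrow> smooth_on S (\<lambda>x. f x * g x)"
  by (simp add: smooth_on_def Ck_on_mult)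

lemma smooth_on_prod:
  fixes f :: "'i \<Rightarrow> 'a::euclidean_space \<Rightarrow> real"
  shows "open S \<Longrightarrow> (\<And>i. i \<in> I \<Longrightarrow> smooth_on S (f i)) \<Longrightarrow> smooth_on S (\<lambda>x. \<Prod>i\<in>I. f i x)"
  by (induction I rule: infinite_finite_induct) (auto intro: smooth_on_const smooth_on_mult)

lemma smooth_on_divide:
  fixes f g :: "'a::euclidean_space \<Rightarrow> real"
  shows "open S \<Longrightarrow> smooth_on S f \<Longrightarrow> smooth_on S g \<Longrightarrow> (\<And>x. x \<in> S \<Longrightarrow> g x \<noteq> 0)
    \<Longrightarrow> smooth_on S (\<lambda>x. f x / g x)"
  by (simp add: smooth_on_def Ck_on_mult Ck_on_inverse divide_inverse)

lemma smooth_on_linear_image: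
  "open S \<Longrightarrow> bounded_linear L \<Longrightarrow> smooth_on S f \<Longrightarrow> smooth_on S (\<lambda>x. L (f x))"
  by (simp add: smooth_on_def Ck_on_linear_image)

lemma smooth_on_slice:
  assumes "smooth_on (U \<times> V) (\<lambda>(x, y). f x y)" "open V" "x \<in> U"
  shows "smooth_on V (f x)"
proof -
  have "Ck_on k V (\<lambda>y. (\<lambda>(x, y). f x y) ((x, 0) + (0, y)))" for k
    by (rule Ck_on_affine_compose[where S="U \<times> V"])
      (use assms in \<open>auto simp: smooth_on_def intro!: bounded_linear_intros\<close>)
  then show ?thesis by (simp add: smooth_on_def)
qed

subsection \<open>Symmetry of second derivatives\<close>

text \<open>Two applications of the mean value theorem, first in direction \<open>u\<close> to the
  increment of \<open>f\<close> by \<open>h *\<^sub>R v\<close>, then in direction \<open>v\<close>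
  to the resulting derivative. The second difference is symmetric in \<open>u\<close> and
  \<open>v\<close>, which is what makes it useful.\<close>

lemma second_difference_mvt:
  fixes f :: "'a::real_normed_vector \<Rightarrow> real"
  assumes "0 < h"
    and S: "\<And>s r. 0 \<le> s \<Longrightarrow> s \<le> h \<Longrightarrow> 0 \<le> r \<Longrightarrow> r \<le> h \<Longrightarrow> z + s *\<^sub>R u + r *\<^sub>R v \<in> S"
    and f: "\<And>x. x \<in> S \<Longrightarrow> f differentiable (at x)"
    and Df: "\<And>x. x \<in> S \<Longrightarrow> (\<lambda>x. frechet_derivative f (at x) u) differentiable (at x)"
  shows "\<exists>s r. 0 < s \<and> s < h \<and> 0 < r \<and> r < h \<and>
    f (z + h *\<^sub>R u + h *\<^sub>R v) - f (z + h *\<^sub>R u) - f (z + h *\<^sub>R v) + f z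
    = h * h * frechet_derivative (\<lambda>x. frechet_derivative f (at x) u) (at (z + s *\<^sub>R u + r *\<^sub>R v)) v"
proof -
  have along: "((\<lambda>s. g (c + s *\<^sub>R w)) has_real_derivative frechet_derivative g (at (c + s *\<^sub>R w)) w) (at s)"
    if "g differentiable (at (c + s *\<^sub>R w))" for g :: "'a \<Rightarrow> real" and c w s
  proof -
    have "((\<lambda>s. c + s *\<^sub>R w) has_derivative (\<lambda>s. s *\<^sub>R w)) (at s)"
      by (auto intro!: derivative_eq_intros)
    then have "((\<lambda>s. g (c + s *\<^sub>R w)) has_derivative (\<lambda>r. frechet_derivative g (at (c + s *\<^sub>R w)) (r *\<^sub>R w))) (at s)"
      using has_derivative_compose that frechet_derivative_works by blast
    moreover have "(\<lambda>r. frechet_derivative g (at (c + s *\<^sub>R w)) (r *\<^sub>R w))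
        = (*) (frechet_derivative g (at (c + s *\<^sub>R w)) w)"
      by (simp add: fun_eq_iff linear_cmul[OF linear_frechet_derivative[OF that]] mult.commute)
    ultimately show ?thesis
      by (simp add: has_field_derivative_def)
  qed
  define p where "p s = f ((z + h *\<^sub>R v) + s *\<^sub>R u) - f (z + s *\<^sub>R u)" for s
  have 1: "(p has_real_derivative frechet_derivative f (at ((z + h *\<^sub>R v) + s *\<^sub>R u)) u
      - frechet_derivative f (at (z + s *\<^sub>R u)) u) (at s)" if "0 \<le> s" "s \<le> h" for s
    unfolding p_def using S[OF that, of h] S[OF that, of 0] assms(1)
    by (intro DERIV_diff along f) (simp_all add: algebra_simps)
  obtain s where s: "0 < s" "s < h" "p h - p 0 = (h - 0) *
      (frechet_derivative f (at ((z + h *\<^sub>R v) + s *\<^sub>R u)) u - frechet_derivative f (at (z + s *\<^sub>R u)) u)"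
    using MVT2[OF assms(1) 1] by blast
  have "((\<lambda>r. frechet_derivative f (at ((z + s *\<^sub>R u) + r *\<^sub>R v)) u) has_real_derivative
      frechet_derivative (\<lambda>x. frechet_derivative f (at x) u) (at ((z + s *\<^sub>R u) + r *\<^sub>R v)) v) (at r)"
    if "0 \<le> r" "r \<le> h" for r
    using s S[of s, OF _ _ that] by (intro along Df) simp
  from MVT2[OF assms(1) this] obtain r where r: "0 < r" "r < h"
    "frechet_derivative f (at ((z + s *\<^sub>R u) + h *\<^sub>R v)) u - frechet_derivative f (at ((z + s *\<^sub>R u) + 0 *\<^sub>R v)) u
     = (h - 0) * frechet_derivative (\<lambda>x. frechet_derivative f (at x) u) (at ((z + s *\<^sub>R u) + r *\<^sub>R v)) v"
    by blast
  show ?thesis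
    by (intro exI[of _ s] exI[of _ r]) (use s r in \<open>simp add: p_def algebra_simps\<close>)
qed

text \<open>Expanding the same second difference in both orders gives two points near
  \<open>z\<close> at which \<open>?A\<close> and \<open>?B\<close> take a common value. By
  continuity this value lies within half of the supposed gap from both \<open>?A z\<close> and
  \<open>?B z\<close>, a contradiction.\<close>

lemma mixed_derivatives_commute:
  fixes f :: "'a::euclidean_space \<Rightarrow> real"
  assumes S: "open S" "z \<in> S" and f: "smooth_on S f"
  shows "frechet_derivative (\<lambda>x. frechet_derivative f (at x) u) (at z) v
       = frechet_derivative (\<lambda>x. frechet_derivative f (at x) v) (at z) u" (is "?A z = ?B z")
proof (rule ccontr)
  assume "?A z \<noteq> ?B z"
  define e where "e = \<bar>?A z - ?B z\<bar> / 2"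
  have "0 < e" using \<open>?A z \<noteq> ?B z\<close> by (simp add: e_def)
  have "continuous_on S ?A" "continuous_on S ?B"
    by (intro smooth_on_continuous smooth_on_frechet f)+
  then obtain d1 d2 where d: "d1 > 0" "\<And>x. x \<in> S \<Longrightarrow> dist x z < d1 \<Longrightarrow> dist (?A x) (?A z) < e"
      "d2 > 0" "\<And>x. x \<in> S \<Longrightarrow> dist x z < d2 \<Longrightarrow> dist (?B x) (?B z) < e"
    using S(2) \<open>0 < e\<close> unfolding continuous_on_iff by metis
  obtain d3 where d3: "d3 > 0" "ball z d3 \<subseteq> S"
    using S open_contains_ball by blast
  define d where "d = Min {d1, d2, d3}"
  \<comment> \<open>The parallelogram with sides \<open>h *\<^sub>R u\<close> and
    \<open>h *\<^sub>R v\<close> must stay within distance \<open>d\<close> of \<open>z\<close>. The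
    summand 1 keeps the denominator positive and makes the bound strict.\<close>
  define h where "h = d / (norm u + norm v + 1)"
  have "0 < d" "d \<le> d1" "d \<le> d2" "d \<le> d3"
    using d d3 by (auto simp: d_def)
  have "0 < h" using \<open>0 < d\<close> by (simp add: h_def add_nonneg_pos)
  have near: "dist (z + s *\<^sub>R u + r *\<^sub>R v) z < d" if "0 \<le> s" "s \<le> h" "0 \<le> r" "r \<le> h" for s r
  proof -
    have "norm (s *\<^sub>R u + r *\<^sub>R v) \<le> s * norm u + r * norm v"
      using norm_triangle_ineq[of "s *\<^sub>R u" "r *\<^sub>R v"] that by simp
    also have "\<dots> \<le> h * norm u + h * norm v"
      using that by (intro add_mono mult_right_mono) auto
    also have "\<dots> < h * (norm u + norm v + 1)"
      using \<open>0 < h\<close> by (simp add: algebra_simps)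
    also have "\<dots> = d"
      by (simp add: h_def add_nonneg_eq_0_iff)
    finally show ?thesis by (simp add: dist_norm add.assoc)
  qed
  have inS: "x \<in> S" if "dist x z < d" for x
    using that d3(2) \<open>d \<le> d3\<close> by (auto simp: dist_commute subset_iff)
  have diff: "f differentiable (at x)" "(\<lambda>x. frechet_derivative f (at x) w) differentiable (at x)"
    if "x \<in> S" for x w
    using that f smooth_on_differentiable smooth_on_frechet by blast+
  have reg: "z + s *\<^sub>R u + r *\<^sub>R v \<in> S" "z + r *\<^sub>R v + s *\<^sub>R u \<in> S"
    if "0 \<le> s" "s \<le> h" "0 \<le> r" "r \<le> h" for s r
    using inS[OF near[OF that]] by (simp_all add: algebra_simps)
  obtain s r where sr: "0 < s" "s < h" "0 < r" "r < h"
    "f (z + h *\<^sub>R u + h *\<^sub>R v) - f (z + h *\<^sub>R u) - f (z + h *\<^sub>R v) + f z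
     = h * h * ?A (z + s *\<^sub>R u + r *\<^sub>R v)"
    using second_difference_mvt[of h z u v S f, OF \<open>0 < h\<close> reg(1) diff(1) diff(2)] by blast
  obtain s' r' where sr': "0 < s'" "s' < h" "0 < r'" "r' < h"
    "f (z + h *\<^sub>R v + h *\<^sub>R u) - f (z + h *\<^sub>R v) - f (z + h *\<^sub>R u) + f z
     = h * h * ?B (z + s' *\<^sub>R v + r' *\<^sub>R u)"
    using second_difference_mvt[of h z v u S f, OF \<open>0 < h\<close> reg(2) diff(1) diff(2)] by blast
  have "h * h * ?A (z + s *\<^sub>R u + r *\<^sub>R v) = h * h * ?B (z + r' *\<^sub>R u + s' *\<^sub>R v)"
    using sr(5) sr'(5) by (simp add: algebra_simps)
  then have eq: "?A (z + s *\<^sub>R u + r *\<^sub>R v) = ?B (z + r' *\<^sub>R u + s' *\<^sub>R v)"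
    using \<open>0 < h\<close> by simp
  have n: "dist (z + s *\<^sub>R u + r *\<^sub>R v) z < d" "dist (z + r' *\<^sub>R u + s' *\<^sub>R v) z < d"
    using near sr sr' by auto
  have "dist (?A (z + s *\<^sub>R u + r *\<^sub>R v)) (?A z) < e"
    using n \<open>d \<le> d1\<close> by (intro d(2) inS) linarith+
  moreover have "dist (?B (z + r' *\<^sub>R u + s' *\<^sub>R v)) (?B z) < e"
    using n \<open>d \<le> d2\<close> by (intro d(4) inS) linarith+
  ultimately show False
    unfolding eq e_def dist_real_def[symmetric] using dist_triangle_half_r by blast
qed

subsection \<open>Partial derivatives\<close>

text \<open>The bridge from one-variable derivatives along coordinate lines to total derivatives:
  the chain rule along the line, where linearity of \<open>f'\<close> extracts the slope.\<close>

lemma partial_deriv_eqI: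
  assumes "(f has_derivative f') (at x)"
  shows "partial_deriv k f x = f' (axis k 1)"
proof -
  have "((\<lambda>s. x + s *\<^sub>R axis k 1) has_derivative (\<lambda>s. s *\<^sub>R axis k 1)) (at 0)"
    by (auto intro!: derivative_eq_intros)
  then have "((\<lambda>s. f (x + s *\<^sub>R axis k 1)) has_derivative (\<lambda>s. f' (s *\<^sub>R axis k 1))) (at 0)"
    using has_derivative_compose[where g=f] assms by fastforce
  then have "((\<lambda>s. f (x + s *\<^sub>R axis k 1)) has_real_derivative f' (axis k 1)) (at 0)"
    by (rule has_derivative_imp_has_field_derivative)
      (simp add: linear_cmul[OF has_derivative_linear[OF assms]])
  then show ?thesis
    unfolding partial_deriv_def by (rule DERIV_imp_deriv)
qed

lemma partial_deriv_frechet: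
  "f differentiable (at x) \<Longrightarrow> partial_deriv k f x = frechet_derivative f (at x) (axis k 1)"
  by (simp add: partial_deriv_eqI frechet_derivative_works)

lemma partial_deriv_cong:
  assumes "open S" "x \<in> S" "\<And>y. y \<in> S \<Longrightarrow> f y = g y"
  shows "partial_deriv k f x = partial_deriv k g x"
  unfolding partial_deriv_def
proof (rule deriv_cong_ev)
  have "open ((\<lambda>s. x + s *\<^sub>R axis k 1) -` S)"
    by (intro open_vimage assms(1) continuous_intros)
  then show "\<forall>\<^sub>F s in nhds 0. f (x + s *\<^sub>R axis k 1) = g (x + s *\<^sub>R axis k 1)"
    using assms by (auto simp: eventually_nhds)
qed simp

lemma partial_deriv_const: "partial_deriv k (\<lambda>y. c) x = 0"
  by (simp add: partial_deriv_def)

lemma partial_deriv_add: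
  assumes "f differentiable (at x)" "g differentiable (at x)"
  shows "partial_deriv k (\<lambda>y. f y + g y) x = partial_deriv k f x + partial_deriv k g x"
  using partial_deriv_eqI[OF has_derivative_add[OF assms[unfolded frechet_derivative_works]]]
  by (simp add: partial_deriv_frechet assms)

lemma partial_deriv_mult:
  assumes "f differentiable (at x)" "g differentiable (at x)"
  shows "partial_deriv k (\<lambda>y. f y * g y) x = f x * partial_deriv k g x + partial_deriv k f x * g x"
  using partial_deriv_eqI[OF has_derivative_mult[OF assms[unfolded frechet_derivative_works]]]
  by (simp add: partial_deriv_frechet assms)

lemma partial_deriv_sum:
  assumes "\<And>i. i \<in> I \<Longrightarrow> f i differentiable (at x)"
  shows "partial_deriv k (\<lambda>y. \<Sum>i\<in>I. f i y) x = (\<Sum>i\<in>I. partial_deriv k (f i) x)"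
  using partial_deriv_eqI[OF has_derivative_sum[OF assms[unfolded frechet_derivative_works]]]
  by (simp add: partial_deriv_frechet assms)

lemma frechet_axis_expansion:
  fixes f :: "real^'n \<Rightarrow> real"
  assumes "f differentiable (at x)"
  shows "frechet_derivative f (at x) v = (\<Sum>k\<in>UNIV. v $ k * partial_deriv k f x)"
proof -
  have "frechet_derivative f (at x) v = frechet_derivative f (at x) (\<Sum>k\<in>UNIV. v $ k *\<^sub>R axis k 1)"
    using basis_expansion[of v] by (simp add: scalar_mult_eq_scaleR)
  then show ?thesis
    using linear_frechet_derivative[OF assms] assms
    by (simp add: linear_sum linear_cmul partial_deriv_frechet)
qed

lemma smooth_on_partial_deriv:
  fixes f :: "real^'n \<Rightarrow> real"
  shows "open S \<Longrightarrow> smooth_on S f \<Longrightarrow> smooth_on S (partial_deriv k f)"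
  using smooth_on_cong[OF smooth_on_frechet] partial_deriv_frechet smooth_on_differentiable
  by metis

section \<open>Functions of a base point and a fibre vector\<close>

lemma has_derivative_slice:
  assumes "(\<lambda>(x, y). f x y) differentiable (at (x, y))"
  shows "(f x has_derivative (\<lambda>v. frechet_derivative (\<lambda>(x, y). f x y) (at (x, y)) (0, v))) (at y)"
    and "((\<lambda>x. f x y) has_derivative (\<lambda>v. frechet_derivative (\<lambda>(x, y). f x y) (at (x, y)) (v, 0))) (at x)"
proof -
  have D: "((\<lambda>(x, y). f x y) has_derivative frechet_derivative (\<lambda>(x, y). f x y) (at (x, y))) (at (x, y))"
    using assms frechet_derivative_works by blast
  have "((\<lambda>y. (x, y)) has_derivative (\<lambda>v. (0, v))) (at y)"
    by (auto intro!: derivative_eq_intros)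
  from has_derivative_compose[OF this D]
  show "(f x has_derivative (\<lambda>v. frechet_derivative (\<lambda>(x, y). f x y) (at (x, y)) (0, v))) (at y)"
    by simp
  have "((\<lambda>x. (x, y)) has_derivative (\<lambda>v. (v, 0))) (at x)"
    by (auto intro!: derivative_eq_intros)
  from has_derivative_compose[OF this D]
  show "((\<lambda>x. f x y) has_derivative (\<lambda>v. frechet_derivative (\<lambda>(x, y). f x y) (at (x, y)) (v, 0))) (at x)"
    by simp
qed

context
  fixes U V :: "(real^'n) set" and f :: "real^'n \<Rightarrow> real^'n \<Rightarrow> real"
  assumes open_UV: "open U" "open V"
    and smooth: "smooth_on (U \<times> V) (\<lambda>(x, y). f x y)"
begin

text \<open>Both kinds of partial derivative become one total derivative on the product, evaluated
  at a fixed vector. Hence repeated partial derivatives remain jointly smooth.\<close>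

lemma partial_deriv_slice:
  assumes "x \<in> U" "y \<in> V"
  shows "partial_deriv k (f x) y = frechet_derivative (\<lambda>(x, y). f x y) (at (x, y)) (0, axis k 1)"
    and "partial_deriv m (\<lambda>z. f z y) x = frechet_derivative (\<lambda>(x, y). f x y) (at (x, y)) (axis m 1, 0)"
  using partial_deriv_eqI has_derivative_slice smooth_on_differentiable[OF smooth, of "(x, y)"] assms
  by blast+

lemma smooth_on_partial_deriv_fibre:
  "smooth_on (U \<times> V) (\<lambda>(x, y). partial_deriv k (f x) y)"
  using open_UV by (intro smooth_on_cong[OF smooth_on_frechet[OF smooth, of "(0, axis k 1)"]] open_Times)
    (auto simp: partial_deriv_slice)

lemma smooth_on_partial_deriv_base:
  "smooth_on (U \<times> V) (\<lambda>(x, y). partial_deriv m (\<lambda>z. f z y) x)"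
  using open_UV by (intro smooth_on_cong[OF smooth_on_frechet[OF smooth, of "(axis m 1, 0)"]] open_Times)
    (auto simp: partial_deriv_slice)

end

text \<open>Symmetry of second derivatives on the product, for one direction along the base and one
  along the fibre. The other steps replace the inner partial derivative by a total derivative on an
  open neighbourhood.\<close>

lemma partial_deriv_commute:
  fixes f :: "real^'n \<Rightarrow> real^'n \<Rightarrow> real"
  assumes UV: "open U" "open V" and f: "smooth_on (U \<times> V) (\<lambda>(x, y). f x y)"
    and xy: "x \<in> U" "y \<in> V"
  shows "partial_deriv n (\<lambda>v. partial_deriv m (\<lambda>z. f z v) x) y
       = partial_deriv m (\<lambda>z. partial_deriv n (f z) y) x"
proof -
  have UV': "open (U \<times> V)" "(x, y) \<in> U \<times> V" using UV xy by (auto intro: open_Times)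
  let ?D = "\<lambda>w p. frechet_derivative (\<lambda>(x, y). f x y) (at p) w"
  have "partial_deriv n (\<lambda>v. partial_deriv m (\<lambda>z. f z v) x) y
      = frechet_derivative (\<lambda>(x, y). partial_deriv m (\<lambda>z. f z y) x) (at (x, y)) (0, axis n 1)"
    using partial_deriv_slice(1)[OF UV smooth_on_partial_deriv_base[OF UV f] xy] .
  also have "\<dots> = frechet_derivative (?D (axis m 1, 0)) (at (x, y)) (0, axis n 1)"
    using smooth_on_differentiable[OF smooth_on_partial_deriv_base[OF UV f] UV'(2)]
    by (subst frechet_derivative_transform_within_open[OF _ UV'])
      (auto simp: partial_deriv_slice[OF UV f])
  also have "\<dots> = frechet_derivative (?D (0, axis n 1)) (at (x, y)) (axis m 1, 0)"
    by (rule mixed_derivatives_commute[OF UV' f])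
  also have "\<dots> = frechet_derivative (\<lambda>(x, y). partial_deriv n (f x) y) (at (x, y)) (axis m 1, 0)"
    using smooth_on_differentiable[OF smooth_on_partial_deriv_fibre[OF UV f] UV'(2)]
    by (subst (2) frechet_derivative_transform_within_open[OF _ UV'])
      (auto simp: partial_deriv_slice[OF UV f])
  also have "\<dots> = partial_deriv m (\<lambda>z. partial_deriv n (f z) y) x"
    using partial_deriv_slice(2)[OF UV smooth_on_partial_deriv_fibre[OF UV f] xy] ..
  finally show ?thesis .
qed

lemma partial_deriv_commute_fibre:
  fixes f :: "real^'n \<Rightarrow> real"
  assumes S: "open S" "x \<in> S" and f: "smooth_on S f"
  shows "partial_deriv n (partial_deriv k f) x = partial_deriv k (partial_deriv n f) x"
proof -
  have "partial_deriv n (partial_deriv k f) x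
      = frechet_derivative (\<lambda>z. frechet_derivative f (at z) (axis k 1)) (at x) (axis n 1)" for n k
  proof -
    have "partial_deriv n (partial_deriv k f) x
        = partial_deriv n (\<lambda>z. frechet_derivative f (at z) (axis k 1)) x"
      by (rule partial_deriv_cong[OF S]) (simp add: partial_deriv_frechet smooth_on_differentiable[OF f])
    also have "\<dots> = frechet_derivative (\<lambda>z. frechet_derivative f (at z) (axis k 1)) (at x) (axis n 1)"
      by (intro partial_deriv_frechet smooth_on_differentiable[OF smooth_on_frechet[OF f] S(2)])
    finally show ?thesis .
  qed
  then show ?thesis
    using mixed_derivatives_commute[OF S f] by simp
qed

section \<open>Euler's theorem for homogeneous functions\<close>

lemma open_slit: "open slit"
  by (rule open_Compl) simp

text \<open>The function sending \<open>s\<close> to \<open>f (s *\<^sub>R y)\<close> is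
  differentiated at 1 twice, by the chain rule and as a power of \<open>s\<close>.\<close>

lemma euler_homogeneous:
  fixes f :: "real^'n \<Rightarrow> real"
  assumes f: "f differentiable (at y)" and hom: "\<And>k. k > 0 \<Longrightarrow> f (k *\<^sub>R y) = k powr r * f y"
  shows "(\<Sum>k\<in>UNIV. y $ k * partial_deriv k f y) = r * f y"
proof -
  have "((\<lambda>s. s *\<^sub>R y) has_derivative (\<lambda>s. s *\<^sub>R y)) (at 1)"
    by (auto intro!: derivative_eq_intros)
  moreover have "(f has_derivative frechet_derivative f (at y)) (at (1 *\<^sub>R y))"
    using f unfolding scaleR_one by (rule frechet_derivative_works[THEN iffD1])
  ultimately have "((\<lambda>s. f (s *\<^sub>R y)) has_derivative (\<lambda>s. frechet_derivative f (at y) (s *\<^sub>R y))) (at 1)"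
    by (rule has_derivative_compose)
  then have "((\<lambda>s. f (s *\<^sub>R y)) has_real_derivative frechet_derivative f (at y) y) (at 1)"
    by (rule has_derivative_imp_has_field_derivative)
      (simp add: linear_cmul[OF linear_frechet_derivative[OF f]])
  moreover have "((\<lambda>s. f (s *\<^sub>R y)) has_real_derivative r * f y) (at 1)"
  \<comment> \<open>Homogeneity is given for positive factors only, so the comparison with the power
    is made on the open half-line around 1.\<close>
  proof (rule has_field_derivative_transform_within_open[where S="{0<..}"])
    show "((\<lambda>s. s powr r * f y) has_real_derivative r * f y) (at 1)"
      by (auto intro!: derivative_eq_intros)
  qed (use hom in auto)
  ultimately have "frechet_derivative f (at y) y = r * f y"
    by (rule DERIV_unique)
  then show ?thesis
    by (simp add: frechet_axis_expansion[OF f])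
qed

text \<open>Differentiating Euler's identity for degree 2 gives Euler's identity of degree 1 for
  each first derivative; contracting with \<open>y\<close> and applying the original identity again
  yields the value. For \<open>F\<^sup>2\<close> this says
  \<open>g(y,y) = F\<^sup>2\<close>.\<close>

lemma euler_homogeneous_second:
  fixes f :: "real^'n \<Rightarrow> real"
  assumes f: "smooth_on slit f" and y: "y \<noteq> 0"
    and hom: "\<And>k y. k > 0 \<Longrightarrow> y \<noteq> 0 \<Longrightarrow> f (k *\<^sub>R y) = k\<^sup>2 * f y"
  shows "(\<Sum>m\<in>UNIV. \<Sum>n\<in>UNIV. y $ m * y $ n * partial_deriv m (partial_deriv n f) y) = 2 * f y"
proof -
  have d: "f differentiable (at v)" "partial_deriv n f differentiable (at v)" if "v \<noteq> 0" for v n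
    using smooth_on_differentiable[OF f] smooth_on_differentiable[OF smooth_on_partial_deriv[OF open_slit f]] that
    by auto
  have euler: "(\<Sum>n\<in>UNIV. v $ n * partial_deriv n f v) = 2 * f v" if "v \<noteq> 0" for v
    by (rule euler_homogeneous) (use d hom that in auto)
  have coord: "partial_deriv m (\<lambda>v :: real^'n. v $ n) y = axis m 1 $ n" "(\<lambda>v :: real^'n. v $ n) differentiable (at y)" for m n
    using bounded_linear_imp_has_derivative[OF bounded_linear_vec_nth, of n "at y"]
    by (auto simp: partial_deriv_eqI differentiable_def)
  have "(\<Sum>n\<in>UNIV. y $ n * partial_deriv m (partial_deriv n f) y) = partial_deriv m f y" for m
  proof -
    have "partial_deriv m (\<lambda>v. \<Sum>n\<in>UNIV. v $ n * partial_deriv n f v) y = partial_deriv m (\<lambda>v. 2 * f v) y"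
      by (rule partial_deriv_cong[OF open_slit]) (use y euler in auto)
    then have "(\<Sum>n\<in>UNIV. y $ n * partial_deriv m (partial_deriv n f) y)
        + (\<Sum>n\<in>UNIV. axis m 1 $ n * partial_deriv n f y) = 2 * partial_deriv m f y"
      by (simp add: partial_deriv_sum partial_deriv_mult partial_deriv_const coord d y
          differentiable_mult sum.distrib)
    moreover have "(\<Sum>n\<in>UNIV. axis m 1 $ n * partial_deriv n f y) = partial_deriv m f y"
      by (simp add: axis_def if_distrib[of "\<lambda>u. u * _"] cong: if_cong)
    ultimately show ?thesis by simp
  qed
  then have "(\<Sum>m\<in>UNIV. y $ m * (\<Sum>n\<in>UNIV. y $ n * partial_deriv m (partial_deriv n f) y)) = 2 * f y"
    using euler y by simp
  then show ?thesis
    by (simp add: sum_distrib_left mult.assoc)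
qed

subsection \<open>Matrices and Christoffel symbols\<close>

lemma sum_rotate:
  "(\<Sum>i\<in>I. \<Sum>j\<in>J. \<Sum>k\<in>K. f i j k) = (\<Sum>k\<in>K. \<Sum>i\<in>I. \<Sum>j\<in>J. f i j k)"
proof -
  have "(\<Sum>i\<in>I. \<Sum>j\<in>J. \<Sum>k\<in>K. f i j k) = (\<Sum>i\<in>I. \<Sum>k\<in>K. \<Sum>j\<in>J. f i j k)"
    by (rule sum.cong[OF refl], rule sum.swap)
  also have "\<dots> = (\<Sum>k\<in>K. \<Sum>i\<in>I. \<Sum>j\<in>J. f i j k)"
    by (rule sum.swap)
  finally show ?thesis .
qed

lemma smooth_on_det:
  fixes M :: "'a::euclidean_space \<Rightarrow> real^'n^'n"
  assumes "open S" "\<And>i j. smooth_on S (\<lambda>x. M x $ i $ j)"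
  shows "smooth_on S (\<lambda>x. det (M x))"
  unfolding det_def by (intro smooth_on_sum smooth_on_mult smooth_on_prod smooth_on_const assms)

text \<open>Cramer's rule writes each component of the solution as a quotient of two determinants
  with smooth entries. It serves to prove the connection coefficients smooth in
  \<open>y\<close>.\<close>

lemma matrix_vector_solution_smooth:
  fixes M :: "'a::euclidean_space \<Rightarrow> real^'n^'n" and b v :: "'a \<Rightarrow> real^'n"
  assumes S: "open S" and M: "\<And>i j. smooth_on S (\<lambda>x. M x $ i $ j)"
    and b: "\<And>i. smooth_on S (\<lambda>x. b x $ i)"
    and inv: "\<And>x. x \<in> S \<Longrightarrow> invertible (M x)" and eq: "\<And>x. x \<in> S \<Longrightarrow> M x *v v x = b x"
  shows "smooth_on S (\<lambda>x. v x $ k)"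
proof -
  let ?C = "\<lambda>x. \<chi> i j. if j = k then b x $ i else M x $ i $ j"
  have nz: "det (M x) \<noteq> 0" if "x \<in> S" for x
    using inv[OF that] by (simp add: invertible_det_nz)
  have "smooth_on S (\<lambda>x. ?C x $ i $ j)" for i j
    using M b by (cases "j = k") simp_all
  then have "smooth_on S (\<lambda>x. det (?C x) / det (M x))"
    using nz by (intro smooth_on_divide smooth_on_det S M)
  then show ?thesis
  proof (rule smooth_on_cong[OF _ S])
    fix x assume "x \<in> S"
    then show "det (?C x) / det (M x) = v x $ k"
      using eq cramer[OF nz, of x "v x" "b x"] by (simp add: vec_eq_iff)
  qed
qed

lemma pos_def_matrix_invertible:
  assumes "pos_def_matrix A"
  shows "invertible A"
  unfolding invertible_left_inverse matrix_left_invertible_ker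
  using assms by (metis inner_zero_right less_irrefl pos_def_matrix_def)

lemma matrix_inv_inverse:
  assumes "invertible A"
  shows "A ** matrix_inv A = mat 1" "matrix_inv A ** A = mat 1"
  using someI_ex[OF assms[unfolded invertible_def]] by (simp_all add: matrix_inv_def)

text \<open>Lowering the upper index cancels the inverse matrix in the definition and leaves the
  Christoffel symbols of the first kind.\<close>

lemma christoffel_lower:
  fixes a :: "real^'n \<Rightarrow> real^'n^'n"
  assumes inv: "invertible (a x)"
  shows "(\<Sum>h\<in>UNIV. a x $ l $ h * christoffel a x h i m)
    = (1/2) * (partial_deriv i (\<lambda>z. a z $ l $ m) x + partial_deriv m (\<lambda>z. a z $ l $ i) x
        - partial_deriv l (\<lambda>z. a z $ i $ m) x)"
proof -
  let ?c = "\<lambda>j. partial_deriv i (\<lambda>z. a z $ j $ m) x + partial_deriv m (\<lambda>z. a z $ j $ i) x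
        - partial_deriv j (\<lambda>z. a z $ i $ m) x"
  have "(\<Sum>h\<in>UNIV. a x $ l $ h * christoffel a x h i m)
      = (1/2) * (\<Sum>h\<in>UNIV. \<Sum>j\<in>UNIV. a x $ l $ h * matrix_inv (a x) $ h $ j * ?c j)"
    by (simp add: christoffel_def sum_distrib_left mult_ac)
  also have "\<dots> = (1/2) * (\<Sum>j\<in>UNIV. (a x ** matrix_inv (a x)) $ l $ j * ?c j)"
    by (subst sum.swap) (simp add: matrix_matrix_mult_def sum_distrib_right)
  also have "a x ** matrix_inv (a x) = mat 1"
    using matrix_inv_inverse[OF inv] by simp
  also have "(\<Sum>j\<in>UNIV. (mat 1 :: real^'n^'n) $ l $ j * ?c j) = ?c l"
    by (simp add: mat_def if_distrib[of "\<lambda>u. u * _"] cong: if_cong)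
  finally show ?thesis .
qed

text \<open>The metric is covariantly constant. In the sum of the two lowered symbols the
  derivatives with respect to \<open>i\<close> and \<open>l\<close> cancel, and the two remaining
  halves agree because \<open>a\<close> is symmetric on a whole neighbourhood of
  \<open>x\<close>.\<close>

lemma christoffel_compatible:
  fixes a :: "real^'n \<Rightarrow> real^'n^'n"
  assumes U: "open U" "x \<in> U" and sym: "\<And>z. z \<in> U \<Longrightarrow> transpose (a z) = a z"
    and inv: "invertible (a x)"
  shows "partial_deriv m (\<lambda>z. a z $ i $ l) x
    = (\<Sum>h\<in>UNIV. a x $ h $ l * christoffel a x h i m) + (\<Sum>h\<in>UNIV. a x $ i $ h * christoffel a x h l m)"
proof -
  have s: "a z $ j $ k = a z $ k $ j" if "z \<in> U" for z j k
    using sym[OF that] by (metis transpose_def vec_lambda_beta)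
  have "(\<Sum>h\<in>UNIV. a x $ h $ l * christoffel a x h i m) = (\<Sum>h\<in>UNIV. a x $ l $ h * christoffel a x h i m)"
    by (simp add: s[OF U(2), of _ l])
  moreover have "partial_deriv m (\<lambda>z. a z $ l $ i) x = partial_deriv m (\<lambda>z. a z $ i $ l) x"
    by (rule partial_deriv_cong[OF U]) (rule s)
  ultimately show ?thesis
    by (simp only: christoffel_lower[where a=a and x=x, OF inv]) (simp add: field_simps)
qed

subsection \<open>Derivatives along a nonlinear connection\<close>

definition horizontal_deriv ::
    "('n \<Rightarrow> real^'n \<Rightarrow> real^'n \<Rightarrow> real) \<Rightarrow> 'n \<Rightarrow> (real^'n \<Rightarrow> real^'n \<Rightarrow> real)
     \<Rightarrow> real^'n \<Rightarrow> real^'n \<Rightarrow> real" where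
  "horizontal_deriv N m f x y =
     partial_deriv m (\<lambda>z. f z y) x + (\<Sum>k\<in>UNIV. N k x y * partial_deriv k (f x) y)"

text \<open>For a jointly differentiable function the operator is the total derivative in the single
  direction with base part \<open>axis m 1\<close> and fibre part \<open>N\<close>. The sum, product
  and chain rules for it are therefore inherited.\<close>

lemma horizontal_deriv_eqI:
  fixes f :: "real^'n \<Rightarrow> real^'n \<Rightarrow> real"
  assumes "((\<lambda>(x, y). f x y) has_derivative f') (at (x, y))"
  shows "horizontal_deriv N m f x y = f' (axis m 1, \<chi> k. N k x y)"
proof -
  have d: "(\<lambda>(x, y). f x y) differentiable (at (x, y))"
    using assms differentiable_def by blast
  have f': "f' = frechet_derivative (\<lambda>(x, y). f x y) (at (x, y))"
    using frechet_derivative_at[OF assms] .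
  note D = has_derivative_slice[OF d, folded f']
  have fd: "f x differentiable (at y)" using D(1) differentiable_def by blast
  have "(axis m (1::real), \<chi> k. N k x y) = (axis m 1, 0) + (0, \<chi> k. N k x y)" by simp
  then have "f' (axis m 1, \<chi> k. N k x y) = f' (axis m 1, 0) + f' (0, \<chi> k. N k x y)"
    by (metis has_derivative_linear[OF assms] linear_add)
  moreover have "f' (0, v) = (\<Sum>k\<in>UNIV. v $ k * partial_deriv k (f x) y)" for v
    using frechet_eqI[OF D(1)] frechet_axis_expansion[OF fd] by simp
  ultimately show ?thesis
    by (simp add: horizontal_deriv_def partial_deriv_eqI[OF D(2)])
qed

lemma horizontal_deriv_cong:
  assumes "open U" "open V" "x \<in> U" "y \<in> V" "\<And>x y. x \<in> U \<Longrightarrow> y \<in> V \<Longrightarrow> f x y = g x y"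
  shows "horizontal_deriv N m f x y = horizontal_deriv N m g x y"
  unfolding horizontal_deriv_def
  using partial_deriv_cong[of U x "\<lambda>z. f z y" "\<lambda>z. g z y"] partial_deriv_cong[of V y "f x" "g x"] assms
  by simp

lemma horizontal_deriv_base: "horizontal_deriv N m (\<lambda>x y. f x) x y = partial_deriv m f x"
  by (simp add: horizontal_deriv_def partial_deriv_const)

lemma horizontal_deriv_mult:
  fixes f g :: "real^'n \<Rightarrow> real^'n \<Rightarrow> real"
  assumes "(\<lambda>(x, y). f x y) differentiable (at (x, y))" "(\<lambda>(x, y). g x y) differentiable (at (x, y))"
  shows "horizontal_deriv N m (\<lambda>x y. f x y * g x y) x y
    = f x y * horizontal_deriv N m g x y + horizontal_deriv N m f x y * g x y"
proof -
  note D = assms[unfolded frechet_derivative_works]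
  have "((\<lambda>(x, y). f x y * g x y) has_derivative
      (\<lambda>v. f x y * frechet_derivative (\<lambda>(x, y). g x y) (at (x, y)) v
         + frechet_derivative (\<lambda>(x, y). f x y) (at (x, y)) v * g x y)) (at (x, y))"
    using has_derivative_mult[OF D] by (simp add: case_prod_unfold)
  from horizontal_deriv_eqI[OF this] show ?thesis
    by (simp add: horizontal_deriv_eqI[OF D(1)] horizontal_deriv_eqI[OF D(2)])
qed

lemma horizontal_deriv_sum:
  fixes f :: "'i \<Rightarrow> real^'n \<Rightarrow> real^'n \<Rightarrow> real"
  assumes "\<And>i. i \<in> I \<Longrightarrow> (\<lambda>(x, y). f i x y) differentiable (at (x, y))"
  shows "horizontal_deriv N m (\<lambda>x y. \<Sum>i\<in>I. f i x y) x y = (\<Sum>i\<in>I. horizontal_deriv N m (f i) x y)"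
proof -
  note D = assms[unfolded frechet_derivative_works]
  have "((\<lambda>(x, y). \<Sum>i\<in>I. f i x y) has_derivative
      (\<lambda>v. \<Sum>i\<in>I. frechet_derivative (\<lambda>(x, y). f i x y) (at (x, y)) v)) (at (x, y))"
    using has_derivative_sum[OF D] by (simp add: case_prod_unfold)
  from horizontal_deriv_eqI[OF this] show ?thesis
    by (simp add: horizontal_deriv_eqI[OF D])
qed

text \<open>
  The hypotheses on \<open>u\<close> and \<open>w\<close> say that their components have the covariant
  derivatives \<open>P\<close> and \<open>Q\<close> along the base.
\<close>

lemma horizontal_deriv_bilinear:
  fixes a :: "real^'n \<Rightarrow> real^'n^'n"
  assumes a: "\<And>i l. (\<lambda>z. a z $ i $ l) differentiable (at x)"
    and u: "\<And>i. (\<lambda>(x, y). u i x y) differentiable (at (x, y))"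
    and w: "\<And>i. (\<lambda>(x, y). w i x y) differentiable (at (x, y))"
    and compat: "\<And>i l. partial_deriv m (\<lambda>z. a z $ i $ l) x
        = (\<Sum>h\<in>UNIV. a x $ h $ l * G h i) + (\<Sum>h\<in>UNIV. a x $ i $ h * G h l)"
    and hu: "\<And>i. horizontal_deriv N m (u i) x y = - (\<Sum>h\<in>UNIV. G i h * u h x y) + P i"
    and hw: "\<And>i. horizontal_deriv N m (w i) x y = - (\<Sum>h\<in>UNIV. G i h * w h x y) + Q i"
  shows "horizontal_deriv N m (\<lambda>x y. \<Sum>i\<in>UNIV. \<Sum>l\<in>UNIV. a x $ i $ l * u i x y * w l x y) x y
    = (\<Sum>i\<in>UNIV. \<Sum>l\<in>UNIV. a x $ i $ l * (P i * w l x y + u i x y * Q l))"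
proof -
  \<comment> \<open>Exchanges the outermost with the innermost summation index, the renaming needed
    to match the terms containing \<open>G h i\<close>.\<close>
  have swap13: "(\<Sum>i\<in>UNIV. \<Sum>l\<in>UNIV. \<Sum>h\<in>UNIV. f i l h) = (\<Sum>i\<in>UNIV. \<Sum>l\<in>UNIV. \<Sum>h\<in>UNIV. f h l i)"
    for f :: "'n \<Rightarrow> 'n \<Rightarrow> 'n \<Rightarrow> real"
  proof -
    have "(\<Sum>i\<in>UNIV. \<Sum>l\<in>UNIV. \<Sum>h\<in>UNIV. f i l h) = (\<Sum>h\<in>UNIV. \<Sum>i\<in>UNIV. \<Sum>l\<in>UNIV. f i l h)"
      by (rule sum_rotate)
    also have "\<dots> = (\<Sum>h\<in>UNIV. \<Sum>l\<in>UNIV. \<Sum>i\<in>UNIV. f i l h)"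
      by (rule sum.cong[OF refl], rule sum.swap)
    finally show ?thesis .
  qed
  have a': "(\<lambda>(x, y). a x $ i $ l) differentiable (at (x, y))" for i l
  proof -
    have "((\<lambda>p. a (fst p) $ i $ l) has_derivative (\<lambda>v. frechet_derivative (\<lambda>z. a z $ i $ l) (at x) (fst v))) (at (x, y))"
      using a[of i l, unfolded frechet_derivative_works]
      by (intro has_derivative_compose[where f=fst and g="\<lambda>z. a z $ i $ l"]) (auto intro: derivative_intros)
    then show ?thesis by (auto simp: differentiable_def case_prod_unfold)
  qed
  have au: "(\<lambda>(x, y). a x $ i $ l * u i x y) differentiable (at (x, y))" for i l
    using differentiable_mult[OF a' u] by (simp add: case_prod_unfold)
  have auw: "(\<lambda>(x, y). a x $ i $ l * u i x y * w l x y) differentiable (at (x, y))" for i l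
    using differentiable_mult[OF au w] by (simp add: case_prod_unfold)
  have auws: "(\<lambda>(x, y). \<Sum>l\<in>UNIV. a x $ i $ l * u i x y * w l x y) differentiable (at (x, y))" for i
    using auw by (auto simp: case_prod_unfold intro!: differentiable_sum)
  have "horizontal_deriv N m (\<lambda>x y. \<Sum>i\<in>UNIV. \<Sum>l\<in>UNIV. a x $ i $ l * u i x y * w l x y) x y
      = (\<Sum>i\<in>UNIV. \<Sum>l\<in>UNIV. a x $ i $ l * u i x y * (- (\<Sum>h\<in>UNIV. G l h * w h x y) + Q l)
          + (a x $ i $ l * (- (\<Sum>h\<in>UNIV. G i h * u h x y) + P i)
            + ((\<Sum>h\<in>UNIV. a x $ h $ l * G h i) + (\<Sum>h\<in>UNIV. a x $ i $ h * G h l)) * u i x y) * w l x y)"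
    by (simp add: horizontal_deriv_sum auw auws horizontal_deriv_mult au w a' u horizontal_deriv_base
        hu hw compat)
  \<comment> \<open>The derivative of \<open>a\<close> contributes two terms with \<open>G\<close>,
    and the transport of \<open>u\<close> and \<open>w\<close> contributes two with the opposite
    sign. They are grouped into pairs that agree after renaming indices, so only \<open>P\<close>
    and \<open>Q\<close> survive.\<close>
  also have "\<dots> = (\<Sum>i\<in>UNIV. \<Sum>l\<in>UNIV. a x $ i $ l * (P i * w l x y + u i x y * Q l))
      + ((\<Sum>i\<in>UNIV. \<Sum>l\<in>UNIV. \<Sum>h\<in>UNIV. a x $ h $ l * G h i * u i x y * w l x y)
        - (\<Sum>i\<in>UNIV. \<Sum>l\<in>UNIV. \<Sum>h\<in>UNIV. a x $ i $ l * G i h * u h x y * w l x y))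
      + ((\<Sum>i\<in>UNIV. \<Sum>l\<in>UNIV. \<Sum>h\<in>UNIV. a x $ i $ h * G h l * u i x y * w l x y)
        - (\<Sum>i\<in>UNIV. \<Sum>l\<in>UNIV. \<Sum>h\<in>UNIV. a x $ i $ l * G l h * u i x y * w h x y))"
    unfolding sum.distrib[symmetric] sum_subtractf[symmetric]
    by (intro sum.cong refl)
      (simp add: sum.distrib sum_subtractf sum_distrib_left algebra_simps)
  also have "(\<Sum>i\<in>UNIV. \<Sum>l\<in>UNIV. \<Sum>h\<in>UNIV. a x $ h $ l * G h i * u i x y * w l x y)
      = (\<Sum>i\<in>UNIV. \<Sum>l\<in>UNIV. \<Sum>h\<in>UNIV. a x $ i $ l * G i h * u h x y * w l x y)"
    by (rule swap13)
  also have "(\<Sum>i\<in>UNIV. \<Sum>l\<in>UNIV. \<Sum>h\<in>UNIV. a x $ i $ h * G h l * u i x y * w l x y)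
      = (\<Sum>i\<in>UNIV. \<Sum>l\<in>UNIV. \<Sum>h\<in>UNIV. a x $ i $ l * G l h * u i x y * w h x y)"
    by (rule sum.cong[OF refl], rule sum.swap)
  finally show ?thesis by simp
qed

text \<open>Partial derivatives commute among themselves, so the commutator comes solely from
  differentiating the coefficients \<open>N\<close>.\<close>

lemma horizontal_deriv_commute:
  fixes f :: "real^'n \<Rightarrow> real^'n \<Rightarrow> real"
  assumes UV: "open U" "open V" and f: "smooth_on (U \<times> V) (\<lambda>(x, y). f x y)"
    and xy: "x \<in> U" "y \<in> V" and N: "\<And>k. N k x differentiable (at y)"
  shows "partial_deriv n (horizontal_deriv N m f x) y
    = horizontal_deriv N m (\<lambda>x. partial_deriv n (f x)) x y
      + (\<Sum>k\<in>UNIV. partial_deriv n (N k x) y * partial_deriv k (f x) y)"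
proof -
  have fx: "smooth_on V (f x)" using smooth_on_slice[OF f UV(2) xy(1)] .
  have d1: "(\<lambda>v. partial_deriv m (\<lambda>z. f z v) x) differentiable (at y)"
    using smooth_on_differentiable[OF smooth_on_slice[OF smooth_on_partial_deriv_base[OF UV f] UV(2) xy(1)] xy(2)] .
  have d2: "partial_deriv k (f x) differentiable (at y)" for k
    using smooth_on_differentiable[OF smooth_on_partial_deriv[OF UV(2) fx] xy(2)] .
  have d3: "(\<lambda>v. N k x v * partial_deriv k (f x) v) differentiable (at y)" for k
    using N d2 by (rule differentiable_mult)
  have "partial_deriv n (horizontal_deriv N m f x) y
      = partial_deriv n (\<lambda>v. partial_deriv m (\<lambda>z. f z v) x
          + (\<Sum>k\<in>UNIV. N k x v * partial_deriv k (f x) v)) y"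
    by (simp add: horizontal_deriv_def[abs_def])
  also have "\<dots> = partial_deriv n (\<lambda>v. partial_deriv m (\<lambda>z. f z v) x) y
      + (\<Sum>k\<in>UNIV. N k x y * partial_deriv n (partial_deriv k (f x)) y
          + partial_deriv n (N k x) y * partial_deriv k (f x) y)"
    by (simp add: partial_deriv_add partial_deriv_sum partial_deriv_mult N d1 d2 d3)
  also have "\<dots> = horizontal_deriv N m (\<lambda>x. partial_deriv n (f x)) x y
      + (\<Sum>k\<in>UNIV. partial_deriv n (N k x) y * partial_deriv k (f x) y)"
    by (simp add: horizontal_deriv_def sum.distrib partial_deriv_commute[OF UV f xy]
        partial_deriv_commute_fibre[OF UV(2) xy(2) fx, of n])
  finally show ?thesis .
qed

subsection \<open>Conformally automorphic Finsler metrics\<close>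

locale conformal_automorphism =
  fixes U :: "(real^'n) set"
    and F :: "real^'n \<Rightarrow> real^'n \<Rightarrow> real"
    and a :: "real^'n \<Rightarrow> real^'n^'n"
    and H :: real
    and t :: "real^'n \<Rightarrow> real^'n \<Rightarrow> real^'n"
  assumes open_U: "open U"
    and finsler: "finsler_metric_on U F"
    and riemannian: "riemannian_metric_on U a"
    and conformal: "conformally_automorphic_via U F a H t"
begin

text \<open>The quantity \<open>a(t,t)\<close>, taken without the square root in
  \<open>riemannian_fun\<close> so that it is a bilinear expression in \<open>t\<close>.\<close>

definition A :: "real^'n \<Rightarrow> real^'n \<Rightarrow> real" where
  "A x y = (\<Sum>i\<in>UNIV. \<Sum>j\<in>UNIV. a x $ i $ j * t x y $ i * t x y $ j)"

definition J :: "real^'n \<Rightarrow> real^'n \<Rightarrow> real^'n^'n" where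
  "J x y = (\<chi> i k. partial_deriv k (\<lambda>v. t x v $ i) y)"

text \<open>The tensor \<open>h\<close> of the overview, proportional to the Finsler tensor with
  factor \<open>p\<^sup>2\<close>.\<close>

definition pullback :: "'n \<Rightarrow> 'n \<Rightarrow> real^'n \<Rightarrow> real^'n \<Rightarrow> real" where
  "pullback m n x y = (\<Sum>i\<in>UNIV. \<Sum>j\<in>UNIV. a x $ i $ j * J x y $ i $ m * J x y $ j $ n)"

text \<open>The lower index comes first, so that \<open>N m\<close> is the family of coefficients
  that \<open>horizontal_deriv\<close> expects together with the same \<open>m\<close>.\<close>

abbreviation N :: "'n \<Rightarrow> 'n \<Rightarrow> real^'n \<Rightarrow> real^'n \<Rightarrow> real" where
  "N m \<equiv> \<lambda>k. nonlinear_conn a t k m"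

section \<open>The hypotheses in separate form and smoothness of the basic functions\<close>

lemma F_smooth: "smooth_on (U \<times> slit) (\<lambda>(x, y). F x y)"
  and F_pos: "x \<in> U \<Longrightarrow> y \<noteq> 0 \<Longrightarrow> 0 < F x y"
  and F_homogeneous: "x \<in> U \<Longrightarrow> y \<noteq> 0 \<Longrightarrow> k > 0 \<Longrightarrow> F x (k *\<^sub>R y) = k * F x y"
  and tensor_pos: "x \<in> U \<Longrightarrow> y \<noteq> 0 \<Longrightarrow> pos_def_matrix (finsler_tensor F x y)"
  using finsler by (auto simp: finsler_metric_on_def)

lemma a_smooth: "smooth_on U a"
  and a_symmetric: "x \<in> U \<Longrightarrow> transpose (a x) = a x"
  and a_pos: "x \<in> U \<Longrightarrow> pos_def_matrix (a x)"
  using riemannian by (auto simp: riemannian_metric_on_def)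

lemma H_pos: "0 < H"
  and t_smooth: "smooth_on (U \<times> slit) (\<lambda>(x, y). t x y)"
  and t_bij: "x \<in> U \<Longrightarrow> bij_betw (t x) slit slit"
  and t_homogeneous: "x \<in> U \<Longrightarrow> y \<noteq> 0 \<Longrightarrow> k > 0 \<Longrightarrow> t x (k *\<^sub>R y) = (k powr H) *\<^sub>R t x y"
  and indicatrix: "x \<in> U \<Longrightarrow> y \<noteq> 0 \<Longrightarrow> F x y = 1 \<longleftrightarrow> riemannian_fun a x (t x y) = 1"
  using conformal by (auto simp: conformally_automorphic_via_def)

lemma t_nonzero: "x \<in> U \<Longrightarrow> y \<noteq> 0 \<Longrightarrow> t x y \<noteq> 0"
  using t_bij bij_betwE by fastforce

lemma tensor_conformal:
  obtains p where "\<And>x y. x \<in> U \<Longrightarrow> y \<noteq> 0 \<Longrightarrow> 0 < p x y"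
    and "\<And>x y m n. x \<in> U \<Longrightarrow> y \<noteq> 0 \<Longrightarrow> finsler_tensor F x y $ m $ n = (p x y)\<^sup>2 * pullback m n x y"
proof -
  from conformal obtain p where "\<forall>x\<in>U. \<forall>y\<in>slit. 0 < p x y \<and>
      (\<forall>m n. finsler_tensor F x y $ m $ n = (p x y)\<^sup>2 * pullback m n x y)"
    unfolding conformally_automorphic_via_def pullback_def J_def vec_lambda_beta by blast
  then show thesis by (intro that[of p]) auto
qed

lemma a_component_smooth: "smooth_on U (\<lambda>x. a x $ i $ j)"
  using smooth_on_linear_image[OF open_U _ a_smooth, of "\<lambda>v. v $ i $ j"]
  by (simp add: bounded_linear_compose[OF bounded_linear_vec_nth bounded_linear_vec_nth])

lemma t_component_smooth: "smooth_on (U \<times> slit) (\<lambda>(x, y). t x y $ i)"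
  using smooth_on_linear_image[OF open_Times[OF open_U open_slit] bounded_linear_vec_nth t_smooth, of i]
  by (simp add: case_prod_unfold)

lemma J_smooth: "smooth_on (U \<times> slit) (\<lambda>(x, y). J x y $ i $ k)"
  using smooth_on_partial_deriv_fibre[OF open_U open_slit t_component_smooth, of k i]
  by (simp add: J_def)

lemma F2_smooth: "smooth_on (U \<times> slit) (\<lambda>(x, y). (F x y)\<^sup>2)"
  using smooth_on_mult[OF open_Times[OF open_U open_slit] F_smooth F_smooth]
  by (simp add: case_prod_unfold power2_eq_square)

lemma jointly_differentiable:
  assumes "smooth_on (U \<times> slit) (\<lambda>(x, y). f x y)" "x \<in> U" "y \<noteq> 0"
  shows "(\<lambda>(x, y). f x y) differentiable (at (x, y))"
  using smooth_on_differentiable[OF assms(1)] assms(2,3) by auto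

section \<open>The length of \<open>t\<close>, the pullback and the Jacobian of
  \<open>t\<close>\<close>

lemma A_pos: "x \<in> U \<Longrightarrow> y \<noteq> 0 \<Longrightarrow> 0 < A x y"
proof -
  assume "x \<in> U" "y \<noteq> 0"
  then have "0 < t x y \<bullet> (a x *v t x y)"
    using a_pos t_nonzero by (auto simp: pos_def_matrix_def)
  also have "\<dots> = A x y"
    by (simp add: A_def inner_vec_def matrix_vector_mult_def sum_distrib_left mult_ac)
  finally show ?thesis .
qed

lemma F_eq_powr:
  assumes "x \<in> U" "y \<noteq> 0"
  shows "F x y = A x y powr (1 / (2 * H))"
proof -
  \<comment> \<open>This factor rescales \<open>y\<close> to the indicatrix, where the hypothesis
    gives \<open>A = 1\<close>. Homogeneity of \<open>t\<close> then turns the rescaling into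
    \<open>A = F\<^sup>2\<^sup>H\<close>.\<close>
  define k where "k = 1 / F x y"
  have "0 < F x y" using F_pos assms by simp
  then have "0 < k" by (simp add: k_def)
  have "F x (k *\<^sub>R y) = 1"
    using F_homogeneous[OF assms \<open>0 < k\<close>] \<open>0 < F x y\<close> by (simp add: k_def)
  then have "riemannian_fun a x (t x (k *\<^sub>R y)) = 1"
    using indicatrix[OF assms(1), of "k *\<^sub>R y"] \<open>0 < k\<close> assms(2) by simp
  then have "(\<Sum>i\<in>UNIV. \<Sum>j\<in>UNIV. a x $ i $ j * (k powr H * t x y $ i) * (k powr H * t x y $ j)) = 1"
    by (simp add: riemannian_fun_def t_homogeneous[OF assms \<open>0 < k\<close>])
  then have "(k powr H * k powr H) * A x y = 1"
    by (simp add: A_def sum_distrib_left mult_ac)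
  then have "A x y = F x y powr (2 * H)"
    using \<open>0 < F x y\<close>
    by (simp add: k_def powr_divide powr_add[symmetric] field_simps flip: mult_2)
  then show ?thesis
    using \<open>0 < F x y\<close> H_pos by (simp add: powr_powr)
qed

text \<open>Coordinate form of \<open>h(v,w) = a(Jv,Jw)\<close>, used for the kernel of
  \<open>J\<close> and for evaluating \<open>h(y,y)\<close>.\<close>

lemma pullback_contract:
  "(\<Sum>m\<in>UNIV. \<Sum>n\<in>UNIV. v $ m * w $ n * pullback m n x y)
    = (\<Sum>i\<in>UNIV. \<Sum>j\<in>UNIV. a x $ i $ j * (J x y *v v) $ i * (J x y *v w) $ j)"
proof -
  let ?f = "\<lambda>m n i j. a x $ i $ j * (J x y $ i $ m * v $ m) * (J x y $ j $ n * w $ n)"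
  have "(\<Sum>m\<in>UNIV. \<Sum>n\<in>UNIV. v $ m * w $ n * pullback m n x y)
      = (\<Sum>m\<in>UNIV. \<Sum>n\<in>UNIV. \<Sum>i\<in>UNIV. \<Sum>j\<in>UNIV. ?f m n i j)"
    by (simp add: pullback_def sum_distrib_left mult_ac)
  also have "\<dots> = (\<Sum>i\<in>UNIV. \<Sum>m\<in>UNIV. \<Sum>n\<in>UNIV. \<Sum>j\<in>UNIV. ?f m n i j)"
    by (rule sum_rotate)
  also have "\<dots> = (\<Sum>i\<in>UNIV. \<Sum>j\<in>UNIV. \<Sum>m\<in>UNIV. \<Sum>n\<in>UNIV. ?f m n i j)"
    by (rule sum.cong[OF refl], rule sum_rotate)
  also have "\<dots> = (\<Sum>i\<in>UNIV. \<Sum>j\<in>UNIV. a x $ i $ j *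
      ((\<Sum>m\<in>UNIV. J x y $ i $ m * v $ m) * (\<Sum>n\<in>UNIV. J x y $ j $ n * w $ n)))"
    by (simp only: sum_product) (simp add: sum_distrib_left mult.assoc)
  finally show ?thesis
    by (simp add: matrix_vector_mult_def mult.assoc)
qed

text \<open>A kernel vector of \<open>J\<close> has pullback length zero, hence also Finsler length
  zero, against positive definiteness of the Finsler tensor.\<close>

lemma J_injective:
  assumes "x \<in> U" "y \<noteq> 0" "J x y *v v = 0"
  shows "v = 0"
proof (rule ccontr)
  assume "v \<noteq> 0"
  obtain p where p: "\<And>m n. finsler_tensor F x y $ m $ n = (p x y)\<^sup>2 * pullback m n x y"
    using tensor_conformal assms by metis
  have "0 < v \<bullet> (finsler_tensor F x y *v v)"
    using tensor_pos assms \<open>v \<noteq> 0\<close> by (auto simp: pos_def_matrix_def)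
  also have "\<dots> = (p x y)\<^sup>2 * (\<Sum>m\<in>UNIV. \<Sum>n\<in>UNIV. v $ m * v $ n * pullback m n x y)"
    by (simp add: inner_vec_def matrix_vector_mult_def p sum_distrib_left mult_ac)
  finally show False
    by (simp add: pullback_contract assms(3))
qed

lemma J_invertible: "x \<in> U \<Longrightarrow> y \<noteq> 0 \<Longrightarrow> invertible (J x y)"
  unfolding invertible_left_inverse matrix_left_invertible_ker using J_injective by blast

lemma t_has_derivative:
  assumes "x \<in> U" "y \<noteq> 0"
  shows "(t x has_derivative (\<lambda>v. J x y *v v)) (at y)"
proof -
  have d: "t x differentiable (at y)"
    using smooth_on_differentiable[OF smooth_on_slice[OF t_smooth open_slit assms(1)]] assms(2) by simp
  then have D: "(t x has_derivative frechet_derivative (t x) (at y)) (at y)"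
    by (simp add: frechet_derivative_works)
  have "frechet_derivative (t x) (at y) = (\<lambda>v. J x y *v v)"
  proof
    fix v
    have "frechet_derivative (t x) (at y) v $ i = (J x y *v v) $ i" for i
    proof -
      have c: "((\<lambda>v. t x v $ i) has_derivative (\<lambda>v. frechet_derivative (t x) (at y) v $ i)) (at y)"
        by (rule bounded_linear.has_derivative[OF bounded_linear_vec_nth D])
      then have "(\<lambda>v. t x v $ i) differentiable (at y)"
        using differentiable_def by blast
      from frechet_axis_expansion[OF this, of v] frechet_eqI[OF c, of v] show ?thesis
        by (simp add: matrix_vector_mult_def J_def mult.commute)
    qed
    then show "frechet_derivative (t x) (at y) v = J x y *v v"
      by (simp add: vec_eq_iff)
  qed
  with D show ?thesis by simp
qed

text \<open>The inverse function theorem, with the global inverse on the slit space supplied by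
  bijectivity. It identifies the factor \<open>y\<^sup>k\<^sub>i\<close> in the connection with an
  entry of the inverse Jacobian.\<close>

lemma partial_deriv_inverse_transf:
  assumes "x \<in> U" "y \<noteq> 0"
  shows "partial_deriv i (\<lambda>u. inverse_transf t x u $ k) (t x y) = matrix_inv (J x y) $ k $ i"
proof -
  have "(inverse_transf t x has_derivative (\<lambda>v. matrix_inv (J x y) *v v)) (at (t x y))"
  proof (rule has_derivative_inverse_strong[OF open_slit, where f="t x"])
    show "continuous_on slit (t x)"
      using smooth_on_continuous[OF smooth_on_slice[OF t_smooth open_slit assms(1)]] .
    show "inverse_transf t x (t x z) = z" if "z \<in> slit" for z
      using t_bij[OF assms(1)] that unfolding inverse_transf_def bij_betw_def by simp
    show "(t x has_derivative (\<lambda>v. J x y *v v)) (at y)"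
      using t_has_derivative[OF assms] .
    show "(\<lambda>v. J x y *v v) \<circ> (\<lambda>v. matrix_inv (J x y) *v v) = id"
      by (simp add: fun_eq_iff matrix_vector_mul_assoc matrix_inv_inverse[OF J_invertible[OF assms]])
  qed (use assms in simp)
  from partial_deriv_eqI[OF bounded_linear.has_derivative[OF bounded_linear_vec_nth this]]
  show ?thesis
    by (simp add: matrix_vector_mult_basis column_def)
qed

text \<open>Multiplication by \<open>J\<close> removes the inverse transformation from the
  definition. The resulting linear system yields both smoothness of the coefficients and the
  transport equation for \<open>t\<close>.\<close>

lemma nonlinear_conn_solves:
  assumes "x \<in> U" "y \<noteq> 0"
  shows "J x y *v (\<chi> k. N m k x y) = (\<chi> i. - (partial_deriv m (\<lambda>z. t z y $ i) x
           + (\<Sum>h\<in>UNIV. christoffel a x i h m * t x y $ h)))" (is "_ = ?b")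
proof -
  have "(\<chi> k. N m k x y) = matrix_inv (J x y) *v ?b"
    by (simp add: vec_eq_iff nonlinear_conn_def partial_deriv_inverse_transf[OF assms]
        matrix_vector_mult_def sum_negf del: minus_add_distrib minus_add)
  then show ?thesis
    by (simp add: matrix_vector_mul_assoc matrix_inv_inverse[OF J_invertible[OF assms]])
qed

lemma nonlinear_conn_smooth:
  assumes "x \<in> U"
  shows "smooth_on slit (nonlinear_conn a t k m x)"
proof -
  let ?b = "\<lambda>y. \<chi> i. - (partial_deriv m (\<lambda>z. t z y $ i) x
           + (\<Sum>h\<in>UNIV. christoffel a x i h m * t x y $ h))"
  have "smooth_on slit (\<lambda>y. (\<chi> k. N m k x y) $ k)"
  proof (rule matrix_vector_solution_smooth[OF open_slit, where M="J x" and b="?b"])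
    show "smooth_on slit (\<lambda>y. J x y $ i $ j)" for i j
      using smooth_on_slice[OF J_smooth open_slit assms] .
    have "smooth_on slit (\<lambda>y. -1 * (partial_deriv m (\<lambda>z. t z y $ i) x
           + (\<Sum>h\<in>UNIV. christoffel a x i h m * t x y $ h)))" for i
      by (intro smooth_on_mult smooth_on_add smooth_on_sum smooth_on_const open_slit
          smooth_on_slice[OF t_component_smooth open_slit assms]
          smooth_on_slice[OF smooth_on_partial_deriv_base[OF open_U open_slit t_component_smooth] open_slit assms])
    then show "smooth_on slit (\<lambda>y. ?b y $ i)" for i by simp
    show "invertible (J x y)" if "y \<in> slit" for y
      using J_invertible assms that by simp
    show "J x y *v (\<chi> k. N m k x y) = ?b y" if "y \<in> slit" for y
      using nonlinear_conn_solves assms that by simp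
  qed
  then show ?thesis by simp
qed

lemma nonlinear_conn_differentiable:
  "x \<in> U \<Longrightarrow> y \<noteq> 0 \<Longrightarrow> nonlinear_conn a t k m x differentiable (at y)"
  using smooth_on_differentiable[OF nonlinear_conn_smooth] by simp

section \<open>Horizontal derivatives of \<open>t\<close>, its Jacobian, \<open>A\<close> and the
  pullback\<close>

lemma horizontal_deriv_partial_commute:
  assumes "smooth_on (U \<times> slit) (\<lambda>(x, y). f x y)" "x \<in> U" "y \<noteq> 0"
  shows "partial_deriv n (horizontal_deriv (N m) m f x) y
    = horizontal_deriv (N m) m (\<lambda>x. partial_deriv n (f x)) x y
      + (\<Sum>k\<in>UNIV. partial_deriv n (N m k x) y * partial_deriv k (f x) y)"
  using horizontal_deriv_commute[where f=f and x=x and y=y and N="N m", OF open_U open_slit]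
    nonlinear_conn_differentiable assms by simp

text \<open>The fibre part of the horizontal derivative is a component of \<open>J\<close> applied
  to the coefficients; by the linear system it cancels the base derivative and leaves only the
  Christoffel term.\<close>

lemma horizontal_deriv_t:
  assumes "x \<in> U" "y \<noteq> 0"
  shows "horizontal_deriv (N m) m (\<lambda>x y. t x y $ i) x y
    = - (\<Sum>h\<in>UNIV. christoffel a x i h m * t x y $ h)"
proof -
  have "(J x y *v (\<chi> k. N m k x y)) $ i = (\<Sum>k\<in>UNIV. N m k x y * partial_deriv k (\<lambda>v. t x v $ i) y)"
    by (simp add: matrix_vector_mult_def J_def mult.commute)
  then show ?thesis
    by (simp add: horizontal_deriv_def nonlinear_conn_solves[OF assms])
qed

text \<open>The transport equation for \<open>t\<close> is differentiated in \<open>y\<close>; the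
  second sum is the commutator term.\<close>

lemma horizontal_deriv_J:
  assumes "x \<in> U" "y \<noteq> 0"
  shows "horizontal_deriv (N m) m (\<lambda>x y. J x y $ i $ n) x y
    = - (\<Sum>h\<in>UNIV. christoffel a x i h m * J x y $ h $ n)
      + - (\<Sum>k\<in>UNIV. partial_deriv n (N m k x) y * J x y $ i $ k)"
proof -
  have d: "(\<lambda>v. t x v $ h) differentiable (at y)" for h
    using smooth_on_differentiable[OF smooth_on_slice[OF t_component_smooth open_slit assms(1)]] assms(2)
    by simp
  define c where "c h = - christoffel a x i h m" for h
  have "partial_deriv n (horizontal_deriv (N m) m (\<lambda>x y. t x y $ i) x) y
      = partial_deriv n (\<lambda>v. \<Sum>h\<in>UNIV. c h * t x v $ h) y"
    by (rule partial_deriv_cong[OF open_slit])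
      (use assms in \<open>simp_all add: horizontal_deriv_t sum_negf c_def\<close>)
  also have "\<dots> = (\<Sum>h\<in>UNIV. c h * J x y $ h $ n)"
    by (simp add: partial_deriv_sum partial_deriv_mult partial_deriv_const d J_def differentiable_mult)
  finally show ?thesis
    using horizontal_deriv_partial_commute[OF t_component_smooth assms, of n m i]
    by (simp add: J_def sum_negf c_def)
qed

lemma christoffel_compatible_chart:
  "x \<in> U \<Longrightarrow> partial_deriv m (\<lambda>z. a z $ i $ l) x
    = (\<Sum>h\<in>UNIV. a x $ h $ l * christoffel a x h i m) + (\<Sum>h\<in>UNIV. a x $ i $ h * christoffel a x h l m)"
  by (rule christoffel_compatible[OF open_U])
    (simp_all add: a_symmetric pos_def_matrix_invertible a_pos)

lemma a_differentiable: "x \<in> U \<Longrightarrow> (\<lambda>z. a z $ i $ l) differentiable (at x)"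
  using smooth_on_differentiable[OF a_component_smooth] .

lemma horizontal_deriv_A:
  assumes "x \<in> U" "y \<noteq> 0"
  shows "horizontal_deriv (N m) m A x y = 0"
proof -
  \<comment> \<open>The zeros stand for \<open>P\<close> and \<open>Q\<close>: the components of
    \<open>t\<close> are parallel, with no correction.\<close>
  have "horizontal_deriv (N m) m A x y
      = (\<Sum>i\<in>UNIV. \<Sum>l\<in>UNIV. a x $ i $ l * (0 * t x y $ l + t x y $ i * 0))"
    unfolding A_def[abs_def]
    by (rule horizontal_deriv_bilinear[OF a_differentiable[OF assms(1)]
          jointly_differentiable[OF t_component_smooth assms] jointly_differentiable[OF t_component_smooth assms]
          christoffel_compatible_chart[OF assms(1)]])
      (simp_all add: horizontal_deriv_t[OF assms])
  then show ?thesis by simp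
qed

text \<open>The bilinear rule, with the commutator terms of the Jacobian as \<open>P\<close> and
  \<open>Q\<close>; carrying out the sums over components of \<open>t\<close> first reassembles the
  pullback.\<close>

lemma horizontal_deriv_h:
  assumes "x \<in> U" "y \<noteq> 0"
  shows "horizontal_deriv (N m) m (pullback n j) x y
    = - (\<Sum>k\<in>UNIV. partial_deriv n (N m k x) y * pullback k j x y)
      - (\<Sum>k\<in>UNIV. partial_deriv j (N m k x) y * pullback n k x y)"
proof -
  let ?D = "\<lambda>n k. partial_deriv n (N m k x) y"
  have "horizontal_deriv (N m) m (pullback n j) x y = (\<Sum>i\<in>UNIV. \<Sum>l\<in>UNIV. a x $ i $ l
      * (- (\<Sum>k\<in>UNIV. ?D n k * J x y $ i $ k) * J x y $ l $ j
         + J x y $ i $ n * - (\<Sum>k\<in>UNIV. ?D j k * J x y $ l $ k)))"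
    unfolding pullback_def[abs_def]
    by (rule horizontal_deriv_bilinear[OF a_differentiable[OF assms(1)]
          jointly_differentiable[OF J_smooth assms] jointly_differentiable[OF J_smooth assms]
          christoffel_compatible_chart[OF assms(1)] horizontal_deriv_J[OF assms] horizontal_deriv_J[OF assms]])
  also have "\<dots> = - (\<Sum>i\<in>UNIV. \<Sum>l\<in>UNIV. \<Sum>k\<in>UNIV. ?D n k * (a x $ i $ l * J x y $ i $ k * J x y $ l $ j))
      - (\<Sum>i\<in>UNIV. \<Sum>l\<in>UNIV. \<Sum>k\<in>UNIV. ?D j k * (a x $ i $ l * J x y $ i $ n * J x y $ l $ k))"
    unfolding sum_negf[symmetric] sum_subtractf[symmetric]
    by (intro sum.cong refl) (simp add: sum_subtractf sum_negf sum_distrib_left algebra_simps)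
  also have "\<dots> = - (\<Sum>k\<in>UNIV. \<Sum>i\<in>UNIV. \<Sum>l\<in>UNIV. ?D n k * (a x $ i $ l * J x y $ i $ k * J x y $ l $ j))
      - (\<Sum>k\<in>UNIV. \<Sum>i\<in>UNIV. \<Sum>l\<in>UNIV. ?D j k * (a x $ i $ l * J x y $ i $ n * J x y $ l $ k))"
    by (rule arg_cong2[where f="(-)"], rule arg_cong[where f=uminus], rule sum_rotate, rule sum_rotate)
  finally show ?thesis
    by (simp add: pullback_def sum_distrib_left)
qed

section \<open>Joint smoothness of the bilinear expressions and of the Finsler tensor\<close>

lemma bilinear_smooth:
  assumes "\<And>i. smooth_on (U \<times> slit) (\<lambda>(x, y). u i x y)" "\<And>i. smooth_on (U \<times> slit) (\<lambda>(x, y). w i x y)"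
  shows "smooth_on (U \<times> (slit :: (real^'n) set))
    (\<lambda>(x, y). \<Sum>i\<in>UNIV. \<Sum>j\<in>UNIV. a x $ i $ j * u i x y * w j x y)"
proof -
  have O: "open (U \<times> (slit :: (real^'n) set))" by (rule open_Times[OF open_U open_slit])
  have a: "smooth_on (U \<times> (slit :: (real^'n) set)) (\<lambda>(x, y). a x $ i $ j)" for i j
  proof -
    have "Ck_on k (U \<times> (slit :: (real^'n) set)) (\<lambda>p. a (0 + fst p) $ i $ j)" for k
      by (rule Ck_on_affine_compose[OF O bounded_linear_fst, where S=U and f="\<lambda>x. a x $ i $ j"])
        (use a_component_smooth in \<open>auto simp: smooth_on_def\<close>)
    then show ?thesis by (simp add: smooth_on_def case_prod_unfold)
  qed
  show ?thesis
    using a assms unfolding case_prod_unfold by (intro smooth_on_sum smooth_on_mult O)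
qed

lemma A_smooth: "smooth_on (U \<times> slit) (\<lambda>(x, y). A x y)"
  unfolding A_def by (intro bilinear_smooth t_component_smooth)

lemma pullback_smooth: "smooth_on (U \<times> slit) (\<lambda>(x, y). pullback m n x y)"
  unfolding pullback_def by (intro bilinear_smooth J_smooth)

lemma F2_partial_smooth:
  "smooth_on (U \<times> slit) (\<lambda>(x, y). partial_deriv j (\<lambda>v. (F x v)\<^sup>2) y)"
  by (rule smooth_on_partial_deriv_fibre[OF open_U open_slit F2_smooth])

lemma tensor_smooth: "smooth_on (U \<times> slit) (\<lambda>(x, y). finsler_tensor F x y $ n $ j)"
  using smooth_on_mult[OF open_Times[OF open_U open_slit] smooth_on_const[of _ "1/2"]
      smooth_on_partial_deriv_fibre[OF open_U open_slit F2_partial_smooth, of n j]]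
  by (simp add: finsler_tensor_def case_prod_unfold)

text \<open>\<open>F\<close> is a power of \<open>A\<close>, so the chain rule leaves a factor that
  vanishes. This is the first assertion of the theorem.\<close>

lemma horizontal_deriv_F:
  assumes "x \<in> U" "y \<noteq> 0"
  shows "horizontal_deriv (N m) m F x y = 0"
proof -
  let ?c = "1 / (2 * H)"
  obtain A' where D: "((\<lambda>(x, y). A x y) has_derivative A') (at (x, y))"
    using jointly_differentiable[OF A_smooth assms] differentiable_def by blast
  then have "((\<lambda>p. A (fst p) (snd p)) has_derivative A') (at (x, y))"
    by (simp add: case_prod_unfold)
  then have D': "((\<lambda>(x, y). A x y powr ?c) has_derivative
      (\<lambda>v. A x y powr ?c * (A' v * ?c / A x y))) (at (x, y))"
    unfolding case_prod_unfold using A_pos[OF assms] by (auto intro!: derivative_eq_intros)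
  have "horizontal_deriv (N m) m F x y = horizontal_deriv (N m) m (\<lambda>x y. A x y powr ?c) x y"
    by (rule horizontal_deriv_cong[OF open_U open_slit]) (use assms F_eq_powr in auto)
  also have "\<dots> = A x y powr ?c * (A' (axis m 1, \<chi> k. N m k x y) * ?c / A x y)"
    by (rule horizontal_deriv_eqI[OF D'])
  also have "A' (axis m 1, \<chi> k. N m k x y) = 0"
    using horizontal_deriv_eqI[OF D, of "N m" m] horizontal_deriv_A[OF assms] by simp
  finally show ?thesis by simp
qed

lemma horizontal_deriv_F2:
  assumes "x \<in> U" "y \<noteq> 0"
  shows "horizontal_deriv (N m) m (\<lambda>x y. (F x y)\<^sup>2) x y = 0"
  using horizontal_deriv_mult[OF jointly_differentiable[OF F_smooth assms] jointly_differentiable[OF F_smooth assms]]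
  by (simp add: power2_eq_square horizontal_deriv_F[OF assms])

text \<open>Contracting \<open>g = p\<^sup>2 h\<close> twice with \<open>y\<close> gives
  \<open>F\<^sup>2 = p\<^sup>2 H\<^sup>2 A\<close>, because Euler's theorem yields
  \<open>J y = H t\<close> and \<open>g(y,y) = F\<^sup>2\<close>. This eliminates \<open>p\<close>,
  which is not assumed differentiable, in favour of smooth functions.\<close>

lemma tensor_scale:
  assumes "x \<in> U" "y \<noteq> 0"
  shows "H\<^sup>2 * A x y * finsler_tensor F x y $ n $ j = (F x y)\<^sup>2 * pullback n j x y"
proof -
  obtain p where p: "\<And>m n. finsler_tensor F x y $ m $ n = (p x y)\<^sup>2 * pullback m n x y"
    using tensor_conformal assms by metis
  have "(J x y *v y) $ i = H * t x y $ i" for i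
  proof -
    have "(\<Sum>k\<in>UNIV. y $ k * partial_deriv k (\<lambda>v. t x v $ i) y) = H * t x y $ i"
      by (rule euler_homogeneous)
        (use assms t_homogeneous smooth_on_differentiable[OF smooth_on_slice[OF t_component_smooth open_slit]] in auto)
    then show ?thesis by (simp add: matrix_vector_mult_def J_def mult.commute)
  qed
  then have "(\<Sum>m\<in>UNIV. \<Sum>n\<in>UNIV. y $ m * y $ n * pullback m n x y) = H\<^sup>2 * A x y"
    unfolding pullback_contract by (simp add: A_def sum_distrib_left power2_eq_square mult_ac)
  moreover have "(\<Sum>m\<in>UNIV. \<Sum>n\<in>UNIV. y $ m * y $ n * partial_deriv m (partial_deriv n (\<lambda>v. (F x v)\<^sup>2)) y)
      = 2 * (F x y)\<^sup>2"
    by (rule euler_homogeneous_second)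
      (use assms F_homogeneous smooth_on_slice[OF F2_smooth open_slit] in \<open>auto simp: power_mult_distrib\<close>)
  then have "(\<Sum>m\<in>UNIV. \<Sum>n\<in>UNIV. y $ m * y $ n * finsler_tensor F x y $ m $ n) = (F x y)\<^sup>2"
    by (simp add: finsler_tensor_def flip: sum_divide_distrib)
  then have "(p x y)\<^sup>2 * (\<Sum>m\<in>UNIV. \<Sum>n\<in>UNIV. y $ m * y $ n * pullback m n x y) = (F x y)\<^sup>2"
    by (simp add: p sum_distrib_left mult_ac)
  ultimately have "(F x y)\<^sup>2 = (p x y)\<^sup>2 * (H\<^sup>2 * A x y)"
    by simp
  then show ?thesis
    by (simp add: p)
qed

section \<open>Transfer to the Finsler tensor and the second derivatives of the connection\<close>

lemma horizontal_deriv_cmult: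
  assumes "smooth_on (U \<times> slit) (\<lambda>(x, y). f x y)" "x \<in> U" "y \<noteq> 0"
  shows "horizontal_deriv M m (\<lambda>x y. c * f x y) x y = c * horizontal_deriv M m f x y"
proof -
  have "(\<lambda>(x, y). c) differentiable (at (x, y))"
    by (simp add: case_prod_unfold)
  from horizontal_deriv_mult[OF this jointly_differentiable[OF assms]] show ?thesis
    by (simp add: horizontal_deriv_base[of M m "\<lambda>x. c"] partial_deriv_const)
qed

text \<open>In \<open>H\<^sup>2 A g = F\<^sup>2 h\<close> both scalar factors have zero horizontal
  derivative, so \<open>g\<close> obeys the same law as \<open>h\<close>; the positive factor
  \<open>H\<^sup>2 A\<close> is cancelled at the end.\<close>

lemma horizontal_deriv_tensor:
  assumes "x \<in> U" "y \<noteq> 0"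
  shows "horizontal_deriv (N m) m (\<lambda>x y. finsler_tensor F x y $ n $ j) x y
    = - (\<Sum>k\<in>UNIV. partial_deriv n (N m k x) y * finsler_tensor F x y $ k $ j)
      - (\<Sum>k\<in>UNIV. partial_deriv j (N m k x) y * finsler_tensor F x y $ n $ k)"
    (is "?L = ?R")
proof -
  have "horizontal_deriv (N m) m (\<lambda>x y. A x y * finsler_tensor F x y $ n $ j) x y = A x y * ?L"
    using horizontal_deriv_mult[OF jointly_differentiable[OF A_smooth assms]
        jointly_differentiable[OF tensor_smooth assms]] by (simp add: horizontal_deriv_A[OF assms])
  moreover have "smooth_on (U \<times> slit) (\<lambda>(x, y). A x y * finsler_tensor F x y $ n $ j)"
    using smooth_on_mult[OF open_Times[OF open_U open_slit] A_smooth tensor_smooth]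
    by (simp add: case_prod_unfold)
  ultimately have "H\<^sup>2 * (A x y * ?L)
      = horizontal_deriv (N m) m (\<lambda>x y. H\<^sup>2 * (A x y * finsler_tensor F x y $ n $ j)) x y"
    by (simp add: horizontal_deriv_cmult assms)
  also have "\<dots> = horizontal_deriv (N m) m (\<lambda>x y. (F x y)\<^sup>2 * pullback n j x y) x y"
    by (rule horizontal_deriv_cong[OF open_U open_slit]) (use assms tensor_scale in \<open>auto simp: mult.assoc\<close>)
  also have "\<dots> = (F x y)\<^sup>2 * horizontal_deriv (N m) m (pullback n j) x y"
    using horizontal_deriv_mult[OF jointly_differentiable[OF F2_smooth assms]
        jointly_differentiable[OF pullback_smooth assms]] by (simp add: horizontal_deriv_F2[OF assms])
  also have "\<dots> = - (\<Sum>k\<in>UNIV. partial_deriv n (N m k x) y * ((F x y)\<^sup>2 * pullback k j x y))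
      - (\<Sum>k\<in>UNIV. partial_deriv j (N m k x) y * ((F x y)\<^sup>2 * pullback n k x y))"
    by (simp add: horizontal_deriv_h[OF assms] right_diff_distrib sum_distrib_left mult_ac)
  also have "\<dots> = H\<^sup>2 * (A x y * ?R)"
    by (simp only: tensor_scale[OF assms, symmetric]) (simp add: right_diff_distrib sum_distrib_left mult_ac)
  finally show ?thesis
    using A_pos[OF assms] H_pos by simp
qed

text \<open>Differentiating the vanishing horizontal derivative of \<open>F\<^sup>2\<close> in
  \<open>y\<close> leaves the commutator as the only other term.\<close>

lemma horizontal_deriv_F2_partial:
  assumes "x \<in> U" "y \<noteq> 0"
  shows "horizontal_deriv (N m) m (\<lambda>x. partial_deriv j (\<lambda>v. (F x v)\<^sup>2)) x y
    = - (\<Sum>k\<in>UNIV. partial_deriv j (N m k x) y * partial_deriv k (\<lambda>v. (F x v)\<^sup>2) y)"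
proof -
  have "partial_deriv j (horizontal_deriv (N m) m (\<lambda>x v. (F x v)\<^sup>2) x) y = partial_deriv j (\<lambda>v. 0) y"
    by (rule partial_deriv_cong[OF open_slit]) (use assms horizontal_deriv_F2 in auto)
  then show ?thesis
    using horizontal_deriv_partial_commute[OF F2_smooth assms, of j m] by (simp add: partial_deriv_const)
qed

text \<open>The preceding identity is differentiated once more in \<open>y\<close>. One evaluation
  uses the product rule and produces the second derivatives of \<open>N\<close>; the other uses the
  commutator and the law for \<open>g\<close>, which contain only first derivatives.\<close>

lemma second_partials_annihilate_covector:
  assumes "x \<in> U" "y \<noteq> 0"
  shows "(\<Sum>k\<in>UNIV. covector F k x y * partial_deriv n (partial_deriv j (N m k x)) y) = 0"
proof -
  let ?L = "\<lambda>x v. (F x v)\<^sup>2"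
  let ?D = "\<lambda>n k. partial_deriv n (N m k x) y"
  have dN: "partial_deriv j (N m k x) differentiable (at y)" for k
    using smooth_on_differentiable[OF smooth_on_partial_deriv[OF open_slit nonlinear_conn_smooth]] assms
    by simp
  have dL: "partial_deriv k (?L x) differentiable (at y)" for k
    using smooth_on_differentiable[OF smooth_on_slice[OF F2_partial_smooth open_slit assms(1)]] assms(2)
    by simp
  have g: "partial_deriv n (partial_deriv j (?L x)) y = 2 * finsler_tensor F x y $ n $ j" for n j x y
    by (simp add: finsler_tensor_def)
  have g': "(\<lambda>x y. 2 * finsler_tensor F x y $ n $ j) = (\<lambda>x. partial_deriv n (partial_deriv j (?L x)))"
    by (intro ext) (simp add: g)
  have "partial_deriv n (horizontal_deriv (N m) m (\<lambda>x. partial_deriv j (?L x)) x) y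
      = partial_deriv n (\<lambda>v. -1 * (\<Sum>k\<in>UNIV. partial_deriv j (N m k x) v * partial_deriv k (?L x) v)) y"
    by (rule partial_deriv_cong[OF open_slit]) (use assms horizontal_deriv_F2_partial in auto)
  also have "\<dots> = - (\<Sum>k\<in>UNIV. ?D j k * partial_deriv n (partial_deriv k (?L x)) y
      + partial_deriv n (partial_deriv j (N m k x)) y * partial_deriv k (?L x) y)"
    using dN dL partial_deriv_mult[where f="\<lambda>v. -1" and x=y and k=n]
    by (simp add: partial_deriv_sum partial_deriv_mult differentiable_mult partial_deriv_const differentiable_sum)
  also have "partial_deriv n (horizontal_deriv (N m) m (\<lambda>x. partial_deriv j (?L x)) x) y
      = horizontal_deriv (N m) m (\<lambda>x y. 2 * finsler_tensor F x y $ n $ j) x y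
        + (\<Sum>k\<in>UNIV. ?D n k * (2 * finsler_tensor F x y $ k $ j))"
    using horizontal_deriv_partial_commute[OF F2_partial_smooth assms, of n m j] by (simp add: g g')
  also have "horizontal_deriv (N m) m (\<lambda>x y. 2 * finsler_tensor F x y $ n $ j) x y
      = - (\<Sum>k\<in>UNIV. ?D n k * (2 * finsler_tensor F x y $ k $ j))
        - (\<Sum>k\<in>UNIV. ?D j k * (2 * finsler_tensor F x y $ n $ k))"
    by (simp add: horizontal_deriv_cmult[OF tensor_smooth assms] horizontal_deriv_tensor[OF assms]
        right_diff_distrib sum_distrib_left mult_ac)
  \<comment> \<open>On the left the two sums with \<open>?D n k\<close> cancel; the remaining sum
    with \<open>?D j k\<close> occurs on both sides. What is left pairs the second derivatives of
    \<open>N\<close> with the gradient of \<open>F\<^sup>2\<close>, twice the covector.\<close>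
  finally have "(\<Sum>k\<in>UNIV. partial_deriv n (partial_deriv j (N m k x)) y * partial_deriv k (?L x) y) = 0"
    by (simp add: g sum.distrib)
  then show ?thesis
    by (simp add: covector_def mult_ac flip: sum_divide_distrib)
qed

end

theorem proposition3p1:
  fixes U :: "(real^'n) set"
    and F :: "real^'n \<Rightarrow> real^'n \<Rightarrow> real"
    and a :: "real^'n \<Rightarrow> real^'n^'n"
    and H :: real
    and t :: "real^'n \<Rightarrow> real^'n \<Rightarrow> real^'n"
  assumes "CARD('n) \<ge> 3"
    and "open U"
    and "finsler_metric_on U F"
    and "riemannian_metric_on U a"
    and "conformally_automorphic_via U F a H t"
  shows "\<forall>x\<in>U. \<forall>y. y \<noteq> 0 \<longrightarrow>
    (\<forall>m. partial_deriv m (\<lambda>z. F z y) x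
          + (\<Sum>k\<in>UNIV. nonlinear_conn a t k m x y * partial_deriv k (F x) y) = 0) \<and>
    (\<forall>m n j. (\<Sum>k\<in>UNIV. covector F k x y *
          partial_deriv n (partial_deriv j (nonlinear_conn a t k m x)) y) = 0)"
proof -
  interpret conformal_automorphism U F a H t
    using assms by unfold_locales
  show ?thesis
    using horizontal_deriv_F second_partials_annihilate_covector
    by (auto simp: horizontal_deriv_def)
qed

end
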